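(* Let $\mathbb{K}$ be a local field (with characteristic different from $2$ if $\mathbb{K}$ is non-Archimedean), and let $n=3$ or $n\geq5$. Then $\mathrm{SL}(n,\mathbb{K})$ is not coarsely injective: $\mathrm{SL}(n,\mathbb{K})$ does not act properly and coboundedly by isometries on an injective metric space.
   Context: A metric space $(Z,d)$ is injective if for any points $(x_i)_{i\in I}$ and nonnegative reals $(r_i)_{i\in I}$ with $r_i+r_j\geq d(x_i,x_j)$ for all $i,j$, the closed balls $B(x_i,r_i)$ have a common point. Proper and cobounded have the usual meaning for isometric actions of a locally compact topological group $G$ on a metric space $Z$: proper means that $\{g\in G\mid d(x,g\cdot x)\leq R\}$ is relatively compact for all $x\in Z$ and $R\geq0$ (the action being continuous), and cobounded means that every point of $Z$ is within a uniformly bounded distance of some orbit. *)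

theory Defs
  imports "HOL-Analysis.Analysis" "HOL-Algebra.Group_Action"
begin

section \<open>Local fields\<close>

text \<open>
  A local field is a field with a nontrivial absolute value whose topology is locally compact;
  completeness follows. Symmetry, the triangle inequality and definiteness of the absolute value
  are supplied by the \<^class>\<open>metric_space\<close> axioms. The constant \<^const>\<open>norm\<close> is
  reserved for real normed vector spaces, which excludes non-Archimedean fields.
\<close>

class local_field = field + metric_space +
  fixes absval :: "'a \<Rightarrow> real"
  assumes dist_absval: "dist x y = absval (x - y)"
    and absval_mult: "absval (x * y) = absval x * absval y"
    and absval_nontrivial: "\<exists>x. x \<noteq> 0 \<and> absval x \<noteq> 1"
    and locally_compact: "\<exists>U K. open U \<and> compact K \<and> x \<in> U \<and> U \<subseteq> K"

instantiation real :: local_field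
begin

definition absval_real :: "real \<Rightarrow> real"
  where "absval_real = norm"

instance
proof
  show "\<exists>x::real. x \<noteq> 0 \<and> absval x \<noteq> 1"
    by (rule exI[of _ 2]) (simp add: absval_real_def)
  show "\<exists>U K. open U \<and> compact K \<and> x \<in> U \<and> U \<subseteq> K" for x :: real
    by (rule exI[of _ "ball x 1"], rule exI[of _ "cball x 1"]) auto
qed (simp_all only: absval_real_def dist_norm norm_mult)

end

instantiation complex :: local_field
begin

definition absval_complex :: "complex \<Rightarrow> real"
  where "absval_complex = norm"

instance
proof
  show "\<exists>x::complex. x \<noteq> 0 \<and> absval x \<noteq> 1"
    by (rule exI[of _ 2]) (simp add: absval_complex_def)
  show "\<exists>U K. open U \<and> compact K \<and> x \<in> U \<and> U \<subseteq> K" for x :: complex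
    by (rule exI[of _ "ball x 1"], rule exI[of _ "cball x 1"]) auto
qed (simp_all only: absval_complex_def dist_norm norm_mult)

end

definition non_archimedean :: "'k::local_field itself \<Rightarrow> bool"
  where "non_archimedean _ \<longleftrightarrow> (\<forall>x y::'k. absval (x + y) \<le> max (absval x) (absval y))"


section \<open>The special linear group\<close>

definition special_linear_group :: "('k::local_field ^ 'n ^ 'n) monoid"
  where "special_linear_group = \<lparr>carrier = {A. det A = 1}, mult = (**), one = mat 1\<rparr>"

definition special_linear_topology :: "('k::local_field ^ 'n ^ 'n) topology"
  where "special_linear_topology = subtopology euclidean (carrier special_linear_group)"

lemma group_special_linear_group:
  "group (special_linear_group :: ('k::local_field ^ 'n ^ 'n) monoid)"
proof (rule groupI)
  fix A :: "'k ^ 'n ^ 'n"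
  assume "A \<in> carrier special_linear_group"
  then have A: "det A = 1" by (simp add: special_linear_group_def)
  then obtain B where B: "A ** B = mat 1" "B ** A = mat 1"
    using invertible_det_nz[of A] by (auto simp: invertible_def)
  then have "det B = 1"
    using A by (metis det_I det_mul mult.left_neutral)
  with B show "\<exists>B\<in>carrier special_linear_group. B \<otimes>\<^bsub>special_linear_group\<^esub> A = \<one>\<^bsub>special_linear_group\<^esub>"
    by (auto simp: special_linear_group_def)
qed (auto simp: special_linear_group_def det_mul matrix_mul_assoc)


section \<open>Injective metric spaces\<close>

text \<open>
  A family of balls is given by its set of (centre, radius) pairs; this loses nothing, as repeated
  members of a family impose no further condition. The empty family is allowed, so an injective
  metric space is nonempty.
\<close>

definition injective_metric :: "'z metric \<Rightarrow> bool"
  where "injective_metric Z \<longleftrightarrow>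
    (\<forall>\<B> \<subseteq> mspace Z \<times> {0..}.
      (\<forall>(x, r)\<in>\<B>. \<forall>(y, s)\<in>\<B>. mdist Z x y \<le> r + s) \<longrightarrow>
      (\<exists>z\<in>mspace Z. \<forall>(x, r)\<in>\<B>. z \<in> mcball_of Z x r))"


section \<open>Proper and cobounded isometric actions\<close>

definition isometric_action :: "('g, 'b) monoid_scheme \<Rightarrow> 'z metric \<Rightarrow> ('g \<Rightarrow> 'z \<Rightarrow> 'z) \<Rightarrow> bool"
  where "isometric_action G Z \<phi> \<longleftrightarrow>
    group_action G (mspace Z) \<phi> \<and>
    (\<forall>g\<in>carrier G. \<forall>x\<in>mspace Z. \<forall>y\<in>mspace Z. mdist Z (\<phi> g x) (\<phi> g y) = mdist Z x y)"

definition proper_action ::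
    "('g, 'b) monoid_scheme \<Rightarrow> 'g topology \<Rightarrow> 'z metric \<Rightarrow> ('g \<Rightarrow> 'z \<Rightarrow> 'z) \<Rightarrow> bool"
  where "proper_action G T Z \<phi> \<longleftrightarrow>
    continuous_map (prod_topology T (mtopology_of Z)) (mtopology_of Z) (\<lambda>(g, z). \<phi> g z) \<and>
    (\<forall>x\<in>mspace Z. \<forall>R\<ge>0. compactin T (T closure_of {g \<in> carrier G. mdist Z x (\<phi> g x) \<le> R}))"

definition cobounded_action ::
    "('g, 'b) monoid_scheme \<Rightarrow> 'z metric \<Rightarrow> ('g \<Rightarrow> 'z \<Rightarrow> 'z) \<Rightarrow> bool"
  where "cobounded_action G Z \<phi> \<longleftrightarrow>
    (\<exists>x\<in>mspace Z. \<exists>R. \<forall>z\<in>mspace Z. \<exists>y\<in>orbit G \<phi> x. mdist Z z y \<le> R)"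

text \<open>
  HOL cannot quantify over types, so the type of points of the metric space is a parameter.
  A theorem that refutes coarse injectivity for a free type variable refutes it for all
  metric spaces.
\<close>

definition coarsely_injective ::
    "'z itself \<Rightarrow> ('g, 'b) monoid_scheme \<Rightarrow> 'g topology \<Rightarrow> bool"
  where "coarsely_injective _ G T \<longleftrightarrow>
    (\<exists>(Z :: 'z metric) \<phi>. injective_metric Z \<and> isometric_action G Z \<phi> \<and>
       proper_action G T Z \<phi> \<and> cobounded_action G Z \<phi>)"

end

theory Submission
  imports Defs
begin

text \<open>
  Suppose that \<open>SL(n, K)\<close> acts properly and coboundedly on an injective space \<open>Z\<close>. The diagonal
  matrices with entries \<open>\<plusminus>1\<close> form a finite group whose fixed point set in \<open>Z\<close> is again
  injective, and the diagonal torus acts coboundedly on it: if \<open>2 \<noteq> 0\<close>, conjugates of the sign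
  matrices determine the conjugates of the coordinate projections. For a fixed point \<open>x\<close> and
  \<open>\<bar>t\<bar> > 1\<close>, the displacement \<open>m \<mapsto> d x (t\<^sup>m x)\<close> is therefore a coarse norm on the lattice of
  integer vectors modulo constants, coarsely invariant under permutations, and its stable seminorm
  \<open>N\<close> on \<open>\<real>\<^sup>n\<close> modulo constants is invariant under the symmetric group and hyperconvex, so that its
  unit ball should be a parallelotope. Concretely, if a vector \<open>v\<close> of Euclidean norm \<open>1\<close> maximises
  \<open>N\<close>, then hyperconvexity forces the permutations of \<open>v\<close> to be linearly independent up to sign. For
  \<open>n = 3\<close> and for \<open>n \<ge> 5\<close> they are not; for \<open>n = 4\<close> the exception is a permutation of a multiple of
  \<open>(1, -1, 1, -1)\<close>.
\<close>

section \<open>Local fields\<close>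

text \<open>Properness alone would allow displacements that grow sublinearly, and then
  \<open>N\<close> could vanish; coarse hyperconvexity is what excludes this
  (\<open>linear_growth\<close>). Instead of classifying hyperconvex norms, the proof looks only at
  the points where the unit ball of \<open>N\<close> touches its largest inscribed Euclidean ball.
  Permuting coordinates carries such points to such points, so every linear relation among the
  permutations of \<open>v\<close> is an obstruction. Relations come from cyclic shifts if n = 3 and
  from two disjoint transpositions if n >= 5. If n = 4, the permutations of (1, -1, 1, -1) are, up
  to sign, three orthogonal vectors, and no relation arises. The sign matrices of determinant 1 are
  chosen because their centraliser is the diagonal torus; if 2 = 0 they are trivial, which is why
  characteristic 2 is excluded.\<close>

lemma absval_zero [simp]: "absval (0 :: 'k::local_field) = 0"
  by (metis diff_self dist_absval dist_self)

lemma absval_nonneg [simp]: "absval (x :: 'k::local_field) \<ge> 0"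
  by (metis diff_zero dist_absval zero_le_dist)

lemma absval_eq_0_iff [simp]: "absval (x :: 'k::local_field) = 0 \<longleftrightarrow> x = 0"
  by (metis diff_zero dist_absval dist_eq_0_iff)

lemma absval_pos_iff [simp]: "absval (x :: 'k::local_field) > 0 \<longleftrightarrow> x \<noteq> 0"
  by (metis absval_eq_0_iff absval_nonneg less_le)

lemma absval_one [simp]: "absval (1 :: 'k::local_field) = 1"
proof -
  have "absval (1::'k) * absval (1::'k) = absval (1::'k)"
    by (metis absval_mult mult_1)
  then show ?thesis
    by simp
qed

lemma absval_minus [simp]: "absval (- x :: 'k::local_field) = absval x"
  by (metis diff_0 diff_zero dist_absval dist_commute)

lemma absval_triangle: "absval (x + y :: 'k::local_field) \<le> absval x + absval y"
  using dist_triangle[of x "- y" 0] by (simp add: dist_absval)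

lemma absval_power: "absval (x ^ n :: 'k::local_field) = absval x ^ n"
  by (induction n) (simp_all add: absval_mult)

lemma absval_inverse: "absval (inverse x :: 'k::local_field) = inverse (absval x)"
proof (cases "x = 0")
  case False
  then have "absval x * absval (inverse x) = 1"
    by (simp flip: absval_mult)
  then show ?thesis
    by (metis inverse_unique)
qed simp

lemma absval_power_int: "absval (x powi n :: 'k::local_field) = absval x powi n"
  by (simp add: power_int_def absval_power absval_inverse)

lemma absval_prod: "absval (\<Prod>i\<in>I. f i :: 'k::local_field) = (\<Prod>i\<in>I. absval (f i))"
  by (induction I rule: infinite_finite_induct) (simp_all add: absval_mult)

lemma absval_sum_le: "absval (\<Sum>i\<in>I. f i :: 'k::local_field) \<le> (\<Sum>i\<in>I. absval (f i))"
proof (induction I rule: infinite_finite_induct)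
  case (insert i I)
  then show ?case
    using absval_triangle[of "f i" "sum f I"] by simp
qed simp_all

lemma absval_sign [simp]: "absval (of_int (sign p) :: 'k::local_field) = 1"
  by (simp add: sign_def)

lemma exists_absval_gt_1: "\<exists>t::'k::local_field. absval t > 1"
proof -
  obtain x :: 'k where x: "x \<noteq> 0" "absval x \<noteq> 1"
    using absval_nontrivial by blast
  show ?thesis
  proof (cases "absval x > 1")
    case False
    then have "absval (inverse x) > 1"
      using x by (simp add: absval_inverse one_less_inverse_iff)
    then show ?thesis ..
  qed blast
qed

section \<open>Compactness and continuity in a local field\<close>

lemma tendsto_mult_left_local_field:
  fixes c :: "'k::local_field"
  assumes "(f \<longlongrightarrow> l) F"
  shows "((\<lambda>x. c * f x) \<longlongrightarrow> c * l) F"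
proof -
  have "((\<lambda>x. absval c * dist (f x) l) \<longlongrightarrow> absval c * 0) F"
    using assms tendsto_dist_iff[of f l F] tendsto_mult_left by blast
  moreover have "dist (c * f x) (c * l) = absval c * dist (f x) l" for x
    by (simp add: dist_absval absval_mult flip: right_diff_distrib)
  ultimately show ?thesis
    by (simp add: tendsto_dist_iff[of "\<lambda>x. c * f x"])
qed

text \<open>Local compactness provides one compact neighbourhood of \<open>0\<close>. Multiplication
  by a small scalar \<open>c\<close> moves a bounded sequence into it, and a convergent subsequence
  found there is scaled back.\<close>

instance local_field \<subseteq> heine_borel
proof
  fix f :: "nat \<Rightarrow> 'a::local_field"
  assume "bounded (range f)"
  then obtain e where e: "\<And>n. absval (f n) \<le> e"
    unfolding bounded_any_center[where a = 0]
    by (auto simp: dist_commute[of 0] dist_absval)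
  obtain U K where UK: "open U" "compact K" "(0::'a) \<in> U" "U \<subseteq> K"
    using locally_compact by blast
  then obtain r where r: "r > 0" "ball 0 r \<subseteq> U"
    using open_contains_ball by blast
  obtain t :: 'a where t: "absval t > 1"
    using exists_absval_gt_1 by blast
  then obtain N where N: "absval t ^ N > e / r"
    using real_arch_pow by blast
  define c where "c = inverse (t ^ N)"
  have c: "c \<noteq> 0"
    using t unfolding c_def by auto
  have "c * f n \<in> K" for n
  proof -
    have "absval (f n) < r * absval t ^ N"
      using e[of n] N r(1) by (simp add: pos_divide_less_eq mult.commute)
    moreover have "absval t ^ N > 0"
      using t by (intro zero_less_power) linarith
    moreover have "absval c = inverse (absval t ^ N)"
      by (simp add: c_def absval_inverse absval_power)
    ultimately have "absval (c * f n) < r"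
      by (simp add: absval_mult field_simps)
    then have "c * f n \<in> ball 0 r"
      by (simp add: dist_commute[of 0] dist_absval)
    then show ?thesis
      using r(2) UK(4) by blast
  qed
  then obtain l s where s: "strict_mono (s :: nat \<Rightarrow> nat)" "((\<lambda>n. c * f n) \<circ> s) \<longlonglongrightarrow> l"
    using UK(2) unfolding compact_def by meson
  have "(\<lambda>n. inverse c * ((\<lambda>n. c * f n) \<circ> s) n) \<longlonglongrightarrow> inverse c * l"
    by (rule tendsto_mult_left_local_field[OF s(2)])
  moreover have "(\<lambda>n. inverse c * ((\<lambda>n. c * f n) \<circ> s) n) = f \<circ> s"
    using c by (auto simp: mult.assoc[symmetric])
  ultimately show "\<exists>l r. strict_mono r \<and> (f \<circ> r) \<longlonglongrightarrow> l"
    using s(1) by metis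
qed

text \<open>This instance and the next make the library rules for sums and products available for
  the continuity of \<open>det\<close>.\<close>

instance local_field \<subseteq> topological_comm_monoid_add
proof
  fix a b :: "'a::local_field"
  have "((\<lambda>p. fst p + snd p) \<longlongrightarrow> a + b) (nhds a \<times>\<^sub>F nhds b)"
  proof (rule metric_tendsto_imp_tendsto[where f = "\<lambda>p. dist (fst p) a + dist (snd p) b" and a = 0])
    show "((\<lambda>p. dist (fst p) a + dist (snd p) b) \<longlongrightarrow> 0) (nhds a \<times>\<^sub>F nhds b)"
      by (rule tendsto_eq_intros filterlim_fst filterlim_snd | simp)+
    show "\<forall>\<^sub>F p in nhds a \<times>\<^sub>F nhds b.
        dist (fst p + snd p) (a + b) \<le> dist (dist (fst p) a + dist (snd p) b) 0"
      by (intro always_eventually allI)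
        (simp add: dist_absval[where 'a = 'a] add_diff_add absval_triangle)
  qed
  then show "((\<lambda>p. fst p + snd p) \<longlongrightarrow> a + b) (nhds a \<times>\<^sub>F nhds b)" .
qed

instance local_field \<subseteq> topological_comm_monoid_mult
proof
  fix a b :: "'a::local_field"
  have "((\<lambda>p. fst p * snd p) \<longlongrightarrow> a * b) (nhds a \<times>\<^sub>F nhds b)"
  proof (rule metric_tendsto_imp_tendsto[where a = 0 and
        f = "\<lambda>p. dist (fst p) a * dist (snd p) b + dist (fst p) a * absval b + absval a * dist (snd p) b"])
    show "((\<lambda>p. dist (fst p) a * dist (snd p) b + dist (fst p) a * absval b + absval a * dist (snd p) b)
        \<longlongrightarrow> 0) (nhds a \<times>\<^sub>F nhds b)"
      by (rule tendsto_eq_intros filterlim_fst filterlim_snd | simp)+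
    have "dist (x * y) (a * b)
        \<le> dist x a * dist y b + dist x a * absval b + absval a * dist y b" for x y
    proof -
      have "x * y - a * b = (x - a) * (y - b) + (x - a) * b + a * (y - b)"
        by (simp add: algebra_simps)
      then show ?thesis
        using absval_triangle[of "(x - a) * (y - b)" "(x - a) * b"]
          absval_triangle[of "(x - a) * (y - b) + (x - a) * b" "a * (y - b)"]
        by (simp add: dist_absval absval_mult)
    qed
    then show "\<forall>\<^sub>F p in nhds a \<times>\<^sub>F nhds b. dist (fst p * snd p) (a * b)
        \<le> dist (dist (fst p) a * dist (snd p) b + dist (fst p) a * absval b + absval a * dist (snd p) b) 0"
      by (intro always_eventually) auto
  qed
  then show "((\<lambda>p. fst p * snd p) \<longlongrightarrow> a * b) (nhds a \<times>\<^sub>F nhds b)" .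
qed

text \<open>If \<open>2 = 0\<close>, then squaring is additive, so that
  \<open>\<bar>x + y\<bar> ^ 2 ^ k \<le> 2 * max \<bar>x\<bar> \<bar>y\<bar> ^ 2 ^ k\<close> for all \<open>k\<close>.\<close>

lemma archimedean_two_neq_0:
  assumes "\<not> non_archimedean TYPE('k::local_field)"
  shows "(2::'k) \<noteq> 0"
proof
  assume two: "(2::'k) = 0"
  obtain x y :: 'k where xy: "absval (x + y) > max (absval x) (absval y)"
    using assms by (auto simp: non_archimedean_def not_le)
  define b where "b = max (absval x) (absval y)"
  have b: "b \<ge> 0" "absval x \<le> b" "absval y \<le> b"
    by (auto simp: b_def le_max_iff_disj)
  have "b > 0"
  proof (rule ccontr)
    assume "\<not> b > 0"
    then have "absval x = 0" "absval y = 0"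
      using b absval_nonneg[of x] absval_nonneg[of y] by linarith+
    then show False
      using xy by simp
  qed
  have frob: "(x + y) ^ 2 ^ k = x ^ 2 ^ k + y ^ 2 ^ k" for k
  proof (induction k)
    case (Suc k)
    have "(u + v)\<^sup>2 = u\<^sup>2 + v\<^sup>2" for u v :: 'k
      by (simp add: power2_sum two)
    moreover have "u ^ 2 ^ Suc k = (u ^ 2 ^ k)\<^sup>2" for u :: 'k
      by (simp add: mult.commute flip: power_mult)
    ultimately show ?case
      by (simp only: Suc)
  qed simp
  have le2: "(absval (x + y) / b) ^ 2 ^ k \<le> 2" for k
  proof -
    have "absval (x + y) ^ 2 ^ k \<le> absval x ^ 2 ^ k + absval y ^ 2 ^ k"
      by (metis frob absval_triangle absval_power)
    also have "\<dots> \<le> 2 * b ^ 2 ^ k"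
      using power_mono[OF b(2), of "2 ^ k"] power_mono[OF b(3), of "2 ^ k"] by simp
    finally show ?thesis
      using \<open>b > 0\<close> by (simp add: power_divide pos_divide_le_eq)
  qed
  have gt1: "absval (x + y) / b > 1"
    using xy \<open>b > 0\<close> by (simp add: b_def)
  then obtain k where "(absval (x + y) / b) ^ k > 2"
    using real_arch_pow by blast
  also have "(absval (x + y) / b) ^ k \<le> (absval (x + y) / b) ^ 2 ^ k"
    using gt1 by (intro power_increasing) (auto simp: less_imp_le)
  finally show False
    using le2[of k] by simp
qed

lemma two_neq_0:
  assumes "non_archimedean TYPE('k::local_field) \<Longrightarrow> CHAR('k) \<noteq> 2"
  shows "(2::'k) \<noteq> 0"
proof (cases "non_archimedean TYPE('k)")
  case True
  show ?thesis
  proof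
    assume "(2::'k) = 0"
    then have "of_nat 2 = (0::'k)"
      by simp
    then have "CHAR('k) dvd 2"
      using of_nat_eq_0_iff_char_dvd by blast
    then have "CHAR('k) = 1 \<or> CHAR('k) = 2"
      using two_is_prime_nat prime_nat_iff by blast
    then show False
      using assms[OF True] by simp
  qed
qed (rule archimedean_two_neq_0)

section \<open>Fixed points in injective metric spaces\<close>

lemma mdist_nonneg [simp]: "mdist Z x y \<ge> 0"
  by (rule Metric_space.nonneg[OF Metric_space_mspace_mdist])

lemma mdist_commute: "mdist Z x y = mdist Z y x"
  by (rule Metric_space.commute[OF Metric_space_mspace_mdist])

lemma mdist_triangle:
  "\<lbrakk>x \<in> mspace Z; y \<in> mspace Z; z \<in> mspace Z\<rbrakk> \<Longrightarrow> mdist Z x z \<le> mdist Z x y + mdist Z y z"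
  by (rule Metric_space.triangle[OF Metric_space_mspace_mdist])

lemma mdist_eq_0_iff:
  "\<lbrakk>x \<in> mspace Z; y \<in> mspace Z\<rbrakk> \<Longrightarrow> mdist Z x y = 0 \<longleftrightarrow> x = y"
  by (rule Metric_space.zero[OF Metric_space_mspace_mdist])

lemma mdist_self [simp]: "x \<in> mspace Z \<Longrightarrow> mdist Z x x = 0"
  by (simp add: mdist_eq_0_iff)

text \<open>The pairs \<open>(x, f x)\<close> are the balls of an admissible family. The iteration
  \<open>h \<mapsto> (h + h\<^sup>*) / 2\<close>, where \<open>h\<^sup>* x = (SUP y. d x y - h y)\<close>, commutes with the isometries
  and decreases to an extremal function, which must be the distance to a point.\<close>

lemma injective_metric_fixed_point:
  assumes Z: "injective_metric Z"
    and bij: "\<And>s. s \<in> S \<Longrightarrow> s ` mspace Z = mspace Z"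
    and iso: "\<And>s x y. \<lbrakk>s \<in> S; x \<in> mspace Z; y \<in> mspace Z\<rbrakk> \<Longrightarrow> mdist Z (s x) (s y) = mdist Z x y"
    and adm: "\<And>x y. \<lbrakk>x \<in> mspace Z; y \<in> mspace Z\<rbrakk> \<Longrightarrow> mdist Z x y \<le> f x + f y"
    and inv: "\<And>s x. \<lbrakk>s \<in> S; x \<in> mspace Z\<rbrakk> \<Longrightarrow> f (s x) = f x"
  shows "\<exists>z\<in>mspace Z. (\<forall>s\<in>S. s z = z) \<and> (\<forall>x\<in>mspace Z. mdist Z z x \<le> f x)"
proof -
  define adm' where "adm' h \<longleftrightarrow> (\<forall>x\<in>mspace Z. \<forall>y\<in>mspace Z. mdist Z x y \<le> h x + h y)" for h
  define inv' where "inv' h \<longleftrightarrow> (\<forall>s\<in>S. \<forall>x\<in>mspace Z. h (s x) = h x)" for h :: "'a \<Rightarrow> real"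
  define st where "st h x = (SUP y\<in>mspace Z. mdist Z x y - h y)" for h x
  define h where "h = rec_nat f (\<lambda>_ g x. (g x + st g x) / 2)"
  have h0: "h 0 = f" and hSuc: "h (Suc k) x = (h k x + st (h k) x) / 2" for k x
    by (simp_all add: h_def)
  have ne: "mspace Z \<noteq> {}"
    using Z unfolding injective_metric_def by blast
  have bdd: "bdd_above ((\<lambda>y. mdist Z x y - g y) ` mspace Z)" if "adm' g" "x \<in> mspace Z" for g x
    using that by (intro bdd_aboveI2[of _ _ "g x"]) (auto simp: adm'_def diff_le_eq)
  have st_le: "st g x \<le> g x" if "adm' g" "x \<in> mspace Z" for g x
    unfolding st_def using that ne by (intro cSUP_least) (auto simp: adm'_def diff_le_eq)
  have st_ge: "mdist Z x y - g y \<le> st g x" if "adm' g" "x \<in> mspace Z" "y \<in> mspace Z" for g x y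
    unfolding st_def using that by (intro cSUP_upper bdd)
  have st_inv: "inv' (st g)" if "inv' g" for g
  proof -
    have "(\<lambda>y. mdist Z (s x) y - g y) ` mspace Z = (\<lambda>y. mdist Z x y - g y) ` mspace Z"
      if s: "s \<in> S" "x \<in> mspace Z" for s x
    proof -
      have "(\<lambda>y. mdist Z (s x) y - g y) ` mspace Z = (\<lambda>y. mdist Z (s x) y - g y) ` s ` mspace Z"
        by (simp only: bij[OF s(1)])
      also have "\<dots> = (\<lambda>y. mdist Z (s x) (s y) - g (s y)) ` mspace Z"
        by (simp only: image_image)
      also have "\<dots> = (\<lambda>y. mdist Z x y - g y) ` mspace Z"
        using s iso \<open>inv' g\<close> by (intro image_cong) (auto simp: inv'_def)
      finally show ?thesis .
    qed
    then show ?thesis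
      by (simp add: inv'_def st_def)
  qed
  have h_adm: "adm' (h k) \<and> inv' (h k)" for k
  proof (induction k)
    case 0
    then show ?case
      using adm inv by (simp add: h0 adm'_def inv'_def)
  next
    case (Suc k)
    \<comment> \<open>Both \<open>st h x + h y\<close> and \<open>h x + st h y\<close> dominate the
      distance; admissibility of the mean is the average of these two inequalities.\<close>
    have "mdist Z x y \<le> h (Suc k) x + h (Suc k) y" if "x \<in> mspace Z" "y \<in> mspace Z" for x y
      using st_ge[of "h k" x y] st_ge[of "h k" y x] Suc that mdist_commute[of Z y x]
      by (simp add: hSuc field_simps)
    then show ?case
      using Suc st_inv[of "h k"] by (auto simp: adm'_def inv'_def hSuc)
  qed
  have h_nonneg: "h k x \<ge> 0" if "x \<in> mspace Z" for k x
    using h_adm[of k] that by (force simp: adm'_def)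
  have h_dec: "decseq (\<lambda>k. h k x)" if "x \<in> mspace Z" for x
    using st_le[of "h _" x] h_adm that by (intro decseq_SucI) (simp add: hSuc)
  define p where "p x = lim (\<lambda>k. h k x)" for x
  have p: "(\<lambda>k. h k x) \<longlonglongrightarrow> p x" if "x \<in> mspace Z" for x
    unfolding p_def using decseq_convergent[OF h_dec[OF that], of 0] h_nonneg[OF that]
    by (metis limI)
  have p_le: "p x \<le> h k x" if "x \<in> mspace Z" for x k
    using decseq_ge[OF h_dec p] that by blast
  have p_adm: "mdist Z x y \<le> p x + p y" if "x \<in> mspace Z" "y \<in> mspace Z" for x y
    using that h_adm
    by (intro tendsto_lowerbound[OF tendsto_add[OF p p]] always_eventually) (auto simp: adm'_def)
  have p_inv: "p (s x) = p x" if "s \<in> S" "x \<in> mspace Z" for s x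
    unfolding p_def using h_adm that by (simp add: inv'_def)
  \<comment> \<open>The recursion gives \<open>st (h k) x = 2 * h (Suc k) x - h k x\<close>, which
    tends to \<open>p x\<close>. Since \<open>st\<close> reverses the order and \<open>p\<close>
    lies below \<open>h k\<close>, this is at most \<open>st p x\<close>.\<close>
  have p_ext: "p x \<le> st p x" if x: "x \<in> mspace Z" for x
  proof -
    have "(\<lambda>k. 2 * h (Suc k) x - h k x) \<longlonglongrightarrow> 2 * p x - p x"
      by (intro tendsto_intros p LIMSEQ_Suc x)
    moreover have "2 * h (Suc k) x - h k x \<le> st p x" for k
    proof -
      have "st (h k) x \<le> st p x"
        unfolding st_def
      proof (rule cSUP_mono[OF ne])
        show "bdd_above ((\<lambda>y. mdist Z x y - p y) ` mspace Z)"
          using p_adm x by (intro bdd) (auto simp: adm'_def)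
        show "\<exists>m\<in>mspace Z. mdist Z x y - h k y \<le> mdist Z x m - p m" if "y \<in> mspace Z" for y
          using p_le[OF that, of k] that by force
      qed
      moreover have "2 * h (Suc k) x = h k x + st (h k) x"
        by (simp add: hSuc)
      ultimately show ?thesis
        by linarith
    qed
    ultimately show ?thesis
      using LIMSEQ_le_const2 by force
  qed
  define B where "B = (\<lambda>x. (x, p x)) ` mspace Z"
  have "p x \<ge> 0" if "x \<in> mspace Z" for x
    using p_adm[OF that that] mdist_nonneg[of Z x x] by linarith
  then have "B \<subseteq> mspace Z \<times> {0..}"
    by (auto simp: B_def)
  moreover have "\<forall>(x, r)\<in>B. \<forall>(y, s)\<in>B. mdist Z x y \<le> r + s"
    using p_adm by (auto simp: B_def)
  ultimately obtain z where "z \<in> mspace Z" and "\<forall>(x, r)\<in>B. z \<in> mcball_of Z x r"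
    using Z unfolding injective_metric_def by meson
  then have z: "z \<in> mspace Z" and z_le: "\<And>x. x \<in> mspace Z \<Longrightarrow> mdist Z z x \<le> p x"
    by (auto simp: B_def mdist_commute)
  have z_ge: "p x \<le> mdist Z z x" if x: "x \<in> mspace Z" for x
  proof -
    have "st p x \<le> mdist Z z x"
      unfolding st_def
    proof (rule cSUP_least[OF ne])
      show "mdist Z x y - p y \<le> mdist Z z x" if "y \<in> mspace Z" for y
        using mdist_triangle[OF x z that] z_le[OF that] by (simp add: mdist_commute)
    qed
    then show ?thesis
      using p_ext[OF x] by linarith
  qed
  show ?thesis
  proof (intro bexI[OF _ z] conjI ballI)
    fix s assume s: "s \<in> S"
    then have sz: "s z \<in> mspace Z"
      using bij z by blast
    \<comment> \<open>As \<open>p\<close> is both invariant and the distance to \<open>z\<close>,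
      the distance from \<open>z\<close> to \<open>s z\<close> is at most
      \<open>p (s z) = p z = 0\<close>.\<close>
    have "mdist Z z (s z) \<le> p z"
      using z_le[OF sz] p_inv[OF s z] by simp
    also have "\<dots> \<le> 0"
      using z_ge[OF z] z by simp
    finally show "s z = z"
      using mdist_nonneg[of Z z "s z"] z sz by (metis mdist_eq_0_iff order_antisym)
  next
    show "mdist Z z x \<le> f x" if "x \<in> mspace Z" for x
      using z_le[OF that] p_le[OF that, of 0] by (simp add: h0)
  qed
qed

text \<open>This is injectivity of the fixed point set. The radii are extended from the centres to a
  function \<open>f\<close> on all of \<open>Z\<close>; it is admissible by the triangle inequality,
  invariant because \<open>S\<close> fixes the centres, and at most \<open>r\<close> at a centre of
  radius \<open>r\<close>.\<close>

lemma injective_metric_fixed_point_balls: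
  assumes Z: "injective_metric Z"
    and bij: "\<And>s. s \<in> S \<Longrightarrow> s ` mspace Z = mspace Z"
    and iso: "\<And>s x y. \<lbrakk>s \<in> S; x \<in> mspace Z; y \<in> mspace Z\<rbrakk> \<Longrightarrow> mdist Z (s x) (s y) = mdist Z x y"
    and B: "B \<noteq> {}" "B \<subseteq> mspace Z \<times> {0..}"
    and le: "\<And>x r y r'. \<lbrakk>(x, r) \<in> B; (y, r') \<in> B\<rbrakk> \<Longrightarrow> mdist Z x y \<le> r + r'"
    and fixed: "\<And>s x r. \<lbrakk>s \<in> S; (x, r) \<in> B\<rbrakk> \<Longrightarrow> s x = x"
  shows "\<exists>z\<in>mspace Z. (\<forall>s\<in>S. s z = z) \<and> (\<forall>(x, r)\<in>B. mdist Z z x \<le> r)"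
proof -
  define f where "f y = (INF (x, r)\<in>B. r + mdist Z x y)" for y
  have bdd: "bdd_below ((\<lambda>(x, r). r + mdist Z x y) ` B)" for y
    using B(2) by (intro bdd_belowI2[where m = 0]) (force intro: add_nonneg_nonneg)
  have f_le: "f y \<le> r + mdist Z x y" if "(x, r) \<in> B" for x r y
    unfolding f_def using cINF_lower[OF bdd that] by auto
  have "\<exists>z\<in>mspace Z. (\<forall>s\<in>S. s z = z) \<and> (\<forall>x\<in>mspace Z. mdist Z z x \<le> f x)"
  proof (rule injective_metric_fixed_point[OF Z bij iso])
    fix y y' assume y: "y \<in> mspace Z" "y' \<in> mspace Z"
    have "mdist Z y y' - f y \<le> r' + mdist Z x' y'" if x': "(x', r') \<in> B" for x' r'
    proof -
      have "mdist Z y y' - (r' + mdist Z x' y') \<le> r + mdist Z x y" if x: "(x, r) \<in> B" for x r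
      proof -
        have "x \<in> mspace Z" "x' \<in> mspace Z"
          using x x' B(2) by auto
        then have "mdist Z y y' \<le> mdist Z x y + (mdist Z x x' + mdist Z x' y')"
          using y mdist_triangle[of y Z x y'] mdist_triangle[of x Z x' y'] by (simp add: mdist_commute)
        then show ?thesis
          using le[OF x x'] by linarith
      qed
      then have "mdist Z y y' - (r' + mdist Z x' y') \<le> f y"
        unfolding f_def using B(1) by (intro cINF_greatest) auto
      then show ?thesis
        by linarith
    qed
    then have "mdist Z y y' - f y \<le> f y'"
      unfolding f_def[of y'] using B(1) by (intro cINF_greatest) auto
    then show "mdist Z y y' \<le> f y + f y'"
      by linarith
  next
    fix s y assume s: "s \<in> S" and y: "y \<in> mspace Z"
    have "mdist Z x (s y) = mdist Z x y" if "(x, r) \<in> B" for x r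
      using iso[OF s _ y, of x] fixed[OF s that] that B(2) by auto
    then show "f (s y) = f y"
      unfolding f_def by (intro INF_cong) auto
  qed (use assms in auto)
  then obtain z where z: "z \<in> mspace Z" "\<forall>s\<in>S. s z = z" "\<And>x. x \<in> mspace Z \<Longrightarrow> mdist Z z x \<le> f x"
    by blast
  moreover have "mdist Z z x \<le> r" if "(x, r) \<in> B" for x r
    using z(3)[of x] f_le[OF that, of x] that B(2) by force
  ultimately show ?thesis
    by blast
qed

section \<open>Symmetric hyperconvex seminorms\<close>

text \<open>A seminorm on real vectors modulo constants. Finite families and the slack
  \<open>\<epsilon>\<close> are what a limit of coarse ball conditions can deliver.\<close>

locale symmetric_hyperconvex_seminorm =
  fixes N :: "real ^ 'n::finite \<Rightarrow> real"
  assumes add: "N (x + y) \<le> N x + N y"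
    and scale: "t \<ge> 0 \<Longrightarrow> N (t *\<^sub>R x) = t * N x"
    and minus: "N (- x) = N x"
    and one: "N 1 = 0"
    and permute: "p permutes UNIV \<Longrightarrow> N (\<chi> i. x $ p i) = N x"
    and nonzero: "\<exists>x. N x > 0"
    and balls: "\<lbrakk>finite B; \<And>x r y r'. \<lbrakk>(x, r) \<in> B; (y, r') \<in> B\<rbrakk> \<Longrightarrow> N (x - y) \<le> r + r'; \<epsilon> > 0\<rbrakk>
      \<Longrightarrow> \<exists>z. \<forall>(x, r)\<in>B. N (z - x) \<le> r + \<epsilon>"
begin

text \<open>Equivalently, the Euclidean ball of radius \<open>1 / N v\<close> lies in the unit ball
  of \<open>N\<close> and touches its boundary at the multiples \<open>v / N v\<close> and
  \<open>- v / N v\<close>.\<close>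

definition maximal :: "real ^ 'n \<Rightarrow> bool"
  where "maximal v \<longleftrightarrow> norm v = 1 \<and> (\<forall>x. N x \<le> N v * norm x)"

lemma zero [simp]: "N 0 = 0"
  using scale[of 0 0] by simp

lemma scale': "N (t *\<^sub>R x) = \<bar>t\<bar> * N x"
  using scale[of "\<bar>t\<bar>" x] minus[of "t *\<^sub>R x"] by (cases "t \<ge> 0") auto

lemma exists_maximal: "\<exists>v. maximal v"
proof -
  have "convex_on UNIV N"
  proof (rule convex_onI)
    fix t x y assume "0 < t" "t < (1::real)"
    then show "N ((1 - t) *\<^sub>R x + t *\<^sub>R y) \<le> (1 - t) * N x + t * N y"
      using add[of "(1 - t) *\<^sub>R x" "t *\<^sub>R y"] by (simp add: scale)
  qed simp
  then have "continuous_on (sphere 0 1) N"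
    using convex_on_continuous[OF open_UNIV] continuous_on_subset by blast
  moreover have "compact (sphere (0 :: real ^ 'n) 1)" "sphere (0 :: real ^ 'n) 1 \<noteq> {}"
    by auto
  ultimately obtain v where v: "v \<in> sphere 0 1" "\<And>x. x \<in> sphere 0 1 \<Longrightarrow> N x \<le> N v"
    using continuous_attains_sup by metis
  have "N x \<le> N v * norm x" for x
  proof (cases "x = 0")
    case False
    then have "N (inverse (norm x) *\<^sub>R x) \<le> N v"
      by (intro v) simp
    with False show ?thesis
      by (simp add: scale field_simps)
  qed simp
  then show ?thesis
    using v(1) by (auto simp: maximal_def)
qed

lemma maximal_pos:
  assumes "maximal v"
  shows "N v > 0"
proof -
  obtain x where "N x > 0"
    using nonzero by blast
  then have "0 < N v * norm x"
    using assms by (meson less_le_trans maximal_def)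
  then show ?thesis
    by (simp add: zero_less_mult_iff)
qed

lemma maximal_unique: "\<lbrakk>maximal v; maximal w\<rbrakk> \<Longrightarrow> N v = N w"
  unfolding maximal_def by (metis mult.right_neutral order_antisym)

lemma maximal_permute:
  assumes "maximal v" "p permutes UNIV"
  shows "maximal (\<chi> i. v $ p i)"
proof -
  have "norm (\<chi> i. v $ p i) = norm v"
    using sum.permute[OF assms(2), of "\<lambda>i. (v $ i)\<^sup>2"]
    by (simp add: norm_vec_def L2_set_def o_def)
  then show ?thesis
    using assms by (simp add: maximal_def permute)
qed

text \<open>Since \<open>N \<le> N v * norm\<close> with equality at \<open>v\<close>, the seminorm \<open>N\<close> has the same derivative at
  \<open>v\<close> as \<open>N v * norm\<close>.\<close>

lemma maximal_supporting:
  assumes "maximal v"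
  shows "N v * (v \<bullet> x) \<le> N x"
proof (rule field_le_epsilon)
  fix e :: real assume e: "e > 0"
  have v: "v \<bullet> v = 1" "N v > 0"
    using assms maximal_pos by (auto simp: maximal_def norm_eq_1)
  \<comment> \<open>Chosen so that the second-order error \<open>N v * (t * (x \<bullet> x))\<close>
    is at most \<open>e\<close>; the \<open>+ 1\<close> covers \<open>x = 0\<close>.\<close>
  define t where "t = e / (N v * (x \<bullet> x + 1))"
  have den: "N v * (x \<bullet> x + 1) > 0"
    using v(2) by (intro mult_pos_pos) (auto intro: add_nonneg_pos)
  have t: "t > 0"
    unfolding t_def using e den by simp
  \<comment> \<open>The first-order expansion of the norm at \<open>v\<close>; the inequality
    \<open>2 * a <= 1 + a^2\<close> removes the square root.\<close>
  have "norm (v - t *\<^sub>R x) \<le> 1 - t * (v \<bullet> x) + t\<^sup>2 * (x \<bullet> x)"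
  proof -
    have "(v - t *\<^sub>R x) \<bullet> (v - t *\<^sub>R x) = 1 - 2 * t * (v \<bullet> x) + t\<^sup>2 * (x \<bullet> x)"
      by (simp add: inner_diff inner_commute[of x v] v(1) power2_eq_square algebra_simps)
    then have "(norm (v - t *\<^sub>R x))\<^sup>2 = 1 - 2 * t * (v \<bullet> x) + t\<^sup>2 * (x \<bullet> x)"
      by (simp only: power2_norm_eq_inner)
    moreover have "2 * norm (v - t *\<^sub>R x) \<le> 1 + (norm (v - t *\<^sub>R x))\<^sup>2"
      using sum_squares_bound[of 1 "norm (v - t *\<^sub>R x)"] by simp
    moreover have "t\<^sup>2 * (x \<bullet> x) \<ge> 0"
      by simp
    ultimately show ?thesis
      by linarith
  qed
  then have "N v * norm (v - t *\<^sub>R x) \<le> N v * (1 - t * (v \<bullet> x) + t\<^sup>2 * (x \<bullet> x))"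
    using v(2) by (intro mult_left_mono) auto
  moreover have "N v \<le> N (v - t *\<^sub>R x) + t * N x"
    using add[of "v - t *\<^sub>R x" "t *\<^sub>R x"] t by (simp add: scale)
  moreover have "N (v - t *\<^sub>R x) \<le> N v * norm (v - t *\<^sub>R x)"
    using assms by (simp add: maximal_def)
  ultimately have "t * (N v * (v \<bullet> x)) \<le> t * (N x + N v * (t * (x \<bullet> x)))"
    by (simp add: algebra_simps power2_eq_square)
  then have "N v * (v \<bullet> x) \<le> N x + N v * (t * (x \<bullet> x))"
    using t by (simp only: mult_le_cancel_left_pos)
  moreover have "N v * (t * (x \<bullet> x)) \<le> e"
  proof -
    have "N v * (t * (x \<bullet> x)) \<le> t * (N v * (x \<bullet> x + 1))"
      using t v(2) by (simp add: algebra_simps)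
    also have "\<dots> = e"
      using den by (metis less_irrefl nonzero_eq_divide_eq t_def)
    finally show ?thesis .
  qed
  ultimately show "N v * (v \<bullet> x) \<le> N x + e"
    by linarith
qed

text \<open>\<open>N\<close> vanishes at \<open>1\<close> and \<open>- 1\<close>, so the supporting
  functional at \<open>v\<close> vanishes on constants.\<close>

lemma maximal_sum:
  assumes "maximal v"
  shows "(\<Sum>i\<in>UNIV. v $ i) = 0"
proof -
  have "N v * (v \<bullet> 1) \<le> 0" "N v * (v \<bullet> - 1) \<le> 0"
    using maximal_supporting[OF assms, of 1] maximal_supporting[OF assms, of "- 1"]
    by (simp_all add: minus one)
  then have "N v * (v \<bullet> 1) = 0"
    by simp
  then show ?thesis
    using maximal_pos[OF assms] by (simp add: inner_vec_def)
qed

lemma (in -) parallelogram_law_norm: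
  "(norm (x + y))\<^sup>2 + (norm (x - y))\<^sup>2 = 2 * (norm x)\<^sup>2 + 2 * (norm (y :: 'a::real_inner))\<^sup>2"
  by (simp add: power2_norm_eq_inner inner_add inner_diff inner_commute)

text \<open>A large ball around \<open>\<mp> s v\<close> tangent to the hyperplane \<open>N v * (v \<bullet> z) = \<gamma>\<close> lies in
  one of its half-spaces. For \<open>w \<noteq> \<plusminus>v\<close> the norms of \<open>v \<plusminus> w\<close> are less than \<open>2\<close>, so that large balls
  in these directions overlap. Hyperconvexity thus lets one prescribe all values \<open>v \<bullet> z\<close>.\<close>

lemma maximal_independent:
  assumes S: "finite S" "\<And>v. v \<in> S \<Longrightarrow> maximal v" "\<And>v. v \<in> S \<Longrightarrow> - v \<notin> S"
  shows "independent S"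
proof
  assume "dependent S"
  \<comment> \<open>The coefficients of the relation serve as the values to prescribe: if
    \<open>M * (v \<bullet> z)\<close> is close to \<open>c v\<close> for every \<open>v\<close>,
    then pairing the relation with \<open>M *\<^sub>R z\<close> yields almost the sum of the squares
    \<open>(c v)^2\<close>, and not 0.\<close>
  then obtain c where c0: "(\<Sum>v\<in>S. c v *\<^sub>R v) = 0" and "\<exists>v\<in>S. c v \<noteq> 0"
    using dependent_finite[OF S(1)] by blast
  then obtain u where u: "u \<in> S" "c u \<noteq> 0"
    by blast
  define M where "M = N u"
  have M: "N v = M" if "v \<in> S" for v
    unfolding M_def using maximal_unique S(2) u(1) that by blast
  have Mpos: "M > 0"
    unfolding M_def using maximal_pos S(2) u(1) by blast
  define Q where "Q = (\<Sum>v\<in>S. (c v)\<^sup>2)"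
  define A where "A = (\<Sum>v\<in>S. \<bar>c v\<bar>)"
  have Q: "Q > 0" and A: "A > 0"
    unfolding Q_def A_def using u S(1) by (auto intro!: sum_pos2)
  \<comment> \<open>With this error per vector the total error is \<open>A * e = Q / 2\<close>, less
    than \<open>Q\<close>.\<close>
  define e where "e = Q / (2 * A)"
  have e: "e > 0"
    using Q A by (simp add: e_def)
  define I where "I = S \<times> {1, - 1 :: real}"
  \<comment> \<open>For opposite centres over the same \<open>v\<close> both sides equal
    \<open>2 * s * M\<close>, since the \<open>c\<close> terms cancel. For all other pairs
    \<open>N (a *\<^sub>R v - b *\<^sub>R w) < 2 * M\<close>, and this gap times \<open>s\<close>
    outgrows the coefficients.\<close>
  have pair: "\<forall>\<^sub>F s in at_top. N ((a * s) *\<^sub>R v - (b * s) *\<^sub>R w) \<le> 2 * s * M + a * c v + b * c w"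
    if "(v, a) \<in> I" "(w, b) \<in> I" for v a w b
  proof (cases "v = w \<and> a = - b")
    case True
    have "N ((a * s) *\<^sub>R v - (b * s) *\<^sub>R w) \<le> 2 * s * M + a * c v + b * c w" if "s \<ge> 0" for s
    proof -
      have "(a * s) *\<^sub>R v - (b * s) *\<^sub>R w = (- (2 * b * s)) *\<^sub>R w"
        using True by (simp add: vec_eq_iff)
      then have "N ((a * s) *\<^sub>R v - (b * s) *\<^sub>R w) = \<bar>- (2 * b * s)\<bar> * M"
        using M \<open>(w, b) \<in> I\<close> by (simp only: scale') (simp add: I_def)
      also have "\<bar>- (2 * b * s)\<bar> = 2 * s"
        using that \<open>(w, b) \<in> I\<close> by (auto simp: I_def)
      finally show ?thesis
        using True by simp
    qed
    then show ?thesis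
      by (rule eventually_mono[OF eventually_ge_at_top])
  next
    case False
    have n1: "norm (a *\<^sub>R v) = 1" "norm (b *\<^sub>R w) = 1"
      using that S(2) by (auto simp: I_def maximal_def)
    have ne: "a *\<^sub>R v \<noteq> - (b *\<^sub>R w)"
      using False that S(3) by (auto simp: I_def)
    have N_lt: "N (a *\<^sub>R v - b *\<^sub>R w) < 2 * M"
    proof -
      have "0 < (norm (a *\<^sub>R v + b *\<^sub>R w))\<^sup>2"
        using ne by (simp add: add_eq_0_iff2)
      moreover have "(norm (a *\<^sub>R v + b *\<^sub>R w))\<^sup>2 + (norm (a *\<^sub>R v - b *\<^sub>R w))\<^sup>2 = 4"
        using parallelogram_law_norm[of "a *\<^sub>R v" "b *\<^sub>R w"] n1 by simp
      ultimately have "(norm (a *\<^sub>R v - b *\<^sub>R w))\<^sup>2 < 2\<^sup>2"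
        unfolding power2_eq_square[of 2] by linarith
      then have "norm (a *\<^sub>R v - b *\<^sub>R w) < 2"
        by (rule power_less_imp_less_base) simp
      moreover have "N (a *\<^sub>R v - b *\<^sub>R w) \<le> M * norm (a *\<^sub>R v - b *\<^sub>R w)"
        using S(2)[OF u(1)] by (simp add: maximal_def M_def)
      moreover have "M * norm (a *\<^sub>R v - b *\<^sub>R w) < M * 2"
        using calculation(1) Mpos by (rule mult_strict_left_mono)
      ultimately show ?thesis
        by linarith
    qed
    define s0 where "s0 = (\<bar>c v\<bar> + \<bar>c w\<bar>) / (2 * M - N (a *\<^sub>R v - b *\<^sub>R w))"
    have "N ((a * s) *\<^sub>R v - (b * s) *\<^sub>R w) \<le> 2 * s * M + a * c v + b * c w"
      if s: "s \<ge> max 0 s0" for s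
    proof -
      have "(a * s) *\<^sub>R v - (b * s) *\<^sub>R w = s *\<^sub>R (a *\<^sub>R v - b *\<^sub>R w)"
        by (simp add: algebra_simps)
      then have "N ((a * s) *\<^sub>R v - (b * s) *\<^sub>R w) = s * N (a *\<^sub>R v - b *\<^sub>R w)"
        using s by (simp only: scale max.bounded_iff)
      moreover have "\<bar>c v\<bar> + \<bar>c w\<bar> \<le> s * (2 * M - N (a *\<^sub>R v - b *\<^sub>R w))"
        using s N_lt by (simp add: s0_def pos_divide_le_eq)
      moreover have "\<bar>a * c v\<bar> = \<bar>c v\<bar>" "\<bar>b * c w\<bar> = \<bar>c w\<bar>"
        using \<open>(v, a) \<in> I\<close> \<open>(w, b) \<in> I\<close> by (auto simp: I_def)
      ultimately show ?thesis
        by (simp add: algebra_simps)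
    qed
    then show ?thesis
      by (rule eventually_mono[OF eventually_ge_at_top])
  qed
  have "\<forall>\<^sub>F s in at_top. \<forall>p\<in>I. \<forall>q\<in>I.
      N ((snd p * s) *\<^sub>R fst p - (snd q * s) *\<^sub>R fst q) \<le> 2 * s * M + snd p * c (fst p) + snd q * c (fst q)"
  proof (intro eventually_ball_finite ballI)
    show "finite I" "finite I"
      using S(1) by (simp_all add: I_def)
    fix p q assume "p \<in> I" "q \<in> I"
    then show "\<forall>\<^sub>F s in at_top. N ((snd p * s) *\<^sub>R fst p - (snd q * s) *\<^sub>R fst q)
        \<le> 2 * s * M + snd p * c (fst p) + snd q * c (fst q)"
      using pair[of "fst p" "snd p" "fst q" "snd q"] by simp
  qed
  then obtain s where s: "\<And>v a w b. \<lbrakk>(v, a) \<in> I; (w, b) \<in> I\<rbrakk> \<Longrightarrow>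
      N ((a * s) *\<^sub>R v - (b * s) *\<^sub>R w) \<le> 2 * s * M + a * c v + b * c w"
    unfolding eventually_at_top_linorder by force
  define B where "B = (\<lambda>(v, a). (- ((a * s) *\<^sub>R v), s * M + a * c v)) ` I"
  have "\<exists>z. \<forall>(x, r)\<in>B. N (z - x) \<le> r + e"
  proof (rule balls)
    show "finite B"
      using S(1) by (simp add: B_def I_def)
    fix x r y r' assume "(x, r) \<in> B" "(y, r') \<in> B"
    then obtain v a w b where vw: "(v, a) \<in> I" "(w, b) \<in> I"
      and x: "x = - ((a * s) *\<^sub>R v)" "r = s * M + a * c v"
      and y: "y = - ((b * s) *\<^sub>R w)" "r' = s * M + b * c w"
      by (auto simp: B_def)
    show "N (x - y) \<le> r + r'"
      using s[OF vw] minus[of "x - y"] by (simp add: x y algebra_simps)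
  qed (rule e)
  then obtain z where z: "\<And>v a. (v, a) \<in> I \<Longrightarrow> N (z + (a * s) *\<^sub>R v) \<le> s * M + a * c v + e"
    by (force simp: B_def)
  \<comment> \<open>The balls with \<open>a = 1\<close> and \<open>a = - 1\<close> bound
    \<open>M * (v \<bullet> z)\<close> from above and from below; the large terms
    \<open>s * M\<close> cancel.\<close>
  have close: "\<bar>M * (v \<bullet> z) - c v\<bar> \<le> e" if v: "v \<in> S" for v
  proof -
    have vv: "v \<bullet> v = 1"
      using S(2)[OF v] by (simp add: maximal_def norm_eq_1)
    have "M * (v \<bullet> (z + s *\<^sub>R v)) \<le> s * M + c v + e"
      using z[of v 1] maximal_supporting[OF S(2)[OF v], of "z + s *\<^sub>R v"] v M[OF v]
      by (simp add: I_def)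
    moreover have "M * (v \<bullet> - (z - s *\<^sub>R v)) \<le> s * M - c v + e"
      using z[of v "-1"] maximal_supporting[OF S(2)[OF v], of "- (z - s *\<^sub>R v)"] v M[OF v]
        minus[of "z - s *\<^sub>R v"]
      by (simp add: I_def)
    ultimately show ?thesis
      by (simp add: inner_add inner_diff vv algebra_simps abs_le_iff)
  qed
  have "Q = (\<Sum>v\<in>S. c v * (c v - M * (v \<bullet> z)))"
  proof -
    have "(\<Sum>v\<in>S. c v * (M * (v \<bullet> z))) = M * ((\<Sum>v\<in>S. c v *\<^sub>R v) \<bullet> z)"
      by (simp add: inner_sum_left sum_distrib_left algebra_simps)
    then show ?thesis
      by (simp add: c0 Q_def right_diff_distrib sum_subtractf power2_eq_square)
  qed
  also have "\<dots> \<le> (\<Sum>v\<in>S. \<bar>c v\<bar> * e)"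
  proof (rule sum_mono)
    fix v assume "v \<in> S"
    have "c v * (c v - M * (v \<bullet> z)) \<le> \<bar>c v\<bar> * \<bar>c v - M * (v \<bullet> z)\<bar>"
      by (metis abs_ge_self abs_mult)
    also have "\<dots> \<le> \<bar>c v\<bar> * e"
      using close[OF \<open>v \<in> S\<close>] by (intro mult_left_mono) (auto simp: abs_minus_commute)
    finally show "c v * (c v - M * (v \<bullet> z)) \<le> \<bar>c v\<bar> * e" .
  qed
  also have "\<dots> = A * e"
    by (simp add: A_def sum_distrib_right)
  also have "\<dots> = Q / 2"
    using A by (simp add: e_def)
  finally show False
    using Q by simp
qed

text \<open>Moving the exceptional entry \<open>b\<close> to each place gives
  \<open>CARD('n)\<close> distinct vectors whose sum is 0. No two are opposite: as there are at
  least three coordinates, any two share one with the nonzero entry \<open>c\<close>.\<close>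

lemma maximal_not_two_valued:
  assumes card: "CARD('n) \<ge> 3" and v: "maximal v" and c: "\<And>j. j \<noteq> i \<Longrightarrow> v $ j = c"
  shows False
proof -
  define b where "b = v $ i"
  define w where "w j = (\<chi> k. if k = j then b else c)" for j :: 'n
  have maxw: "maximal (w j)" for j
  proof -
    have "w j = (\<chi> k. v $ Transposition.transpose i j k)"
      using c by (auto simp: w_def vec_eq_iff b_def Transposition.transpose_def)
    then show ?thesis
      using maximal_permute[OF v, of "Transposition.transpose i j"] permutes_swap_id[of i UNIV j]
      by simp
  qed
  have sum0: "(\<Sum>k\<in>UNIV. if k = j then b else c) = 0" for j :: 'n
    using maximal_sum[OF maxw[of j]] by (simp add: w_def)
  have "c \<noteq> 0"
  proof
    assume "c = 0"
    then have "(\<Sum>k\<in>UNIV. if k = i then b else 0) = 0"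
      using sum0[of i] by (simp only:)
    then have "b = 0"
      by simp
    then have "v = 0"
      using \<open>c = 0\<close> c by (metis b_def vec_eq_iff zero_index)
    then show False
      using v by (simp add: maximal_def)
  qed
  then have "b \<noteq> c"
    using sum0[of i] card by auto
  have inj: "w j = w l \<Longrightarrow> j = l" for j l
    using \<open>b \<noteq> c\<close> by (auto simp: w_def vec_eq_iff) (metis)
  have neg: "- w j \<noteq> w l" for j l
  proof -
    have "card {j, l} < CARD('n)"
      using card by (intro le_less_trans[OF card_insert_le_m1[of 2]]) auto
    then obtain k where "k \<notin> {j, l}"
      by (metis UNIV_I finite.emptyI finite.insertI less_irrefl subsetI subset_antisym)
    then show ?thesis
      using \<open>c \<noteq> 0\<close> by (auto simp: w_def vec_eq_iff intro!: exI[of _ k])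
  qed
  have "independent (range w)"
    using maxw neg by (intro maximal_independent) (simp, blast, blast)
  moreover have eq: "- (\<Sum>j\<in>UNIV - {i}. w j) = w i"
  proof -
    have "(\<Sum>j\<in>UNIV. w j) = 0"
      using sum0 by (simp add: vec_eq_iff w_def eq_commute[of _ "_ :: 'n"])
    then show ?thesis
      by (simp add: sum.remove[of _ i] add_eq_0_iff2)
  qed
  have "- (\<Sum>j\<in>UNIV - {i}. w j) \<in> span (range w - {w i})"
    using inj by (intro span_neg span_sum span_base) auto
  then have "w i \<in> span (range w - {w i})"
    by (simp only: eq)
  ultimately show False
    by (auto simp: dependent_def)
qed

text \<open>Swapping \<open>i, j\<close> and \<open>k, l\<close> independently gives four vectors
  with \<open>v + v3 = v1 + v2\<close>. Two of them could be opposite only if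
  \<open>v $ m = 0\<close> and \<open>v $ i = - v $ j\<close>.\<close>

lemma maximal_four_point:
  assumes v: "maximal v" and dist: "distinct [i, j, k, l, m]"
    and neq: "v $ i \<noteq> v $ j" "v $ k \<noteq> v $ l" and "v $ m \<noteq> 0 \<or> v $ i \<noteq> - v $ j"
  shows False
proof -
  define p where "p = Transposition.transpose i j"
  define q where "q = Transposition.transpose k l"
  have perm: "p permutes UNIV" "q permutes UNIV"
    by (auto simp: p_def q_def permutes_swap_id)
  define v1 where "v1 = (\<chi> n. v $ p n)"
  define v2 where "v2 = (\<chi> n. v $ q n)"
  define v3 where "v3 = (\<chi> n. v1 $ q n)"
  have max: "maximal v1" "maximal v2" "maximal v3"
    unfolding v3_def v1_def v2_def using v perm maximal_permute by blast+
  have i: "v1 $ i = v $ j" "v2 $ i = v $ i" "v3 $ i = v $ j"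
    and j: "v1 $ j = v $ i" "v2 $ j = v $ j" "v3 $ j = v $ i"
    and k: "v1 $ k = v $ k" "v2 $ k = v $ l" "v3 $ k = v $ l"
    and m: "v1 $ m = v $ m" "v2 $ m = v $ m" "v3 $ m = v $ m"
    using dist by (auto simp: v1_def v2_def v3_def p_def q_def Transposition.transpose_def)
  have ne: "v3 \<noteq> v" "v3 \<noteq> v1" "v3 \<noteq> v2"
    using i k neq by metis+
  have "- x \<notin> {v, v1, v2, v3}" if "x \<in> {v, v1, v2, v3}" for x
  proof
    assume neg: "- x \<in> {v, v1, v2, v3}"
    from assms(5) show False
    proof
      assume "v $ m \<noteq> 0"
      moreover have "y $ m = v $ m" if "y \<in> {v, v1, v2, v3}" for y
        using that m by auto
      from this[OF that] this[OF neg] have "v $ m = 0"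
        by simp
      ultimately show False
        by simp
    next
      assume *: "v $ i \<noteq> - v $ j"
      have "y $ i = v $ i \<and> y $ j = v $ j \<or> y $ i = v $ j \<and> y $ j = v $ i"
        if "y \<in> {v, v1, v2, v3}" for y
        using that i j by auto
      from this[OF that] this[OF neg] show False
        using * neq(1) by auto
    qed
  qed
  then have "independent {v, v1, v2, v3}"
    using v max by (intro maximal_independent) auto
  moreover have eq: "v1 + v2 - v = v3"
    using dist
    by (auto simp: vec_eq_iff v1_def v2_def v3_def p_def q_def Transposition.transpose_def)
  have "v1 + v2 - v \<in> span ({v, v1, v2, v3} - {v3})"
    using ne by (intro span_add span_diff span_base) blast+
  then have "v3 \<in> span ({v, v1, v2, v3} - {v3})"
    by (simp only: eq)
  ultimately show False
    unfolding dependent_def by blast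
qed

text \<open>The three cyclic shifts add up to 0 because the coordinates do. A shift that fixes
  \<open>v\<close> would make it constant, hence 0; one that negates \<open>v\<close> would, applied
  three times, give \<open>v = - v\<close>.\<close>

lemma maximal_cyclic:
  assumes v: "maximal v" and U: "UNIV = {i, j, k :: 'n}" "distinct [i, j, k]"
  shows False
proof -
  have U_all: "(\<forall>n. P n) \<longleftrightarrow> P i \<and> P j \<and> P k" for P
    using U(1) by (metis UNIV_I empty_iff insert_iff)
  define p where "p = Transposition.transpose i j \<circ> Transposition.transpose j k"
  have p: "p permutes UNIV" "p i = j" "p j = k" "p k = i"
    using U(2) by (auto simp: p_def Transposition.transpose_def intro!: permutes_compose permutes_swap_id)
  define v1 where "v1 = (\<chi> n. v $ p n)"
  define v2 where "v2 = (\<chi> n. v1 $ p n)"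
  have max: "maximal v1" "maximal v2"
    unfolding v2_def v1_def using v p(1) maximal_permute by blast+
  have co: "v1 $ i = v $ j" "v1 $ j = v $ k" "v1 $ k = v $ i"
    "v2 $ i = v $ k" "v2 $ j = v $ i" "v2 $ k = v $ j"
    by (simp_all add: v1_def v2_def p)
  have sum0: "v $ i + v $ j + v $ k = 0"
  proof -
    have "(\<Sum>n\<in>UNIV. v $ n) = (\<Sum>n\<in>{i, j, k}. v $ n)"
      by (simp only: U(1))
    then show ?thesis
      using maximal_sum[OF v] U(2) by simp
  qed
  have "v \<noteq> 0"
    using v by (auto simp: maximal_def)
  then have nz: "\<not> (v $ i = 0 \<and> v $ j = 0 \<and> v $ k = 0)"
    by (simp add: vec_eq_iff U_all)
  have ne: "v2 \<noteq> v" "v2 \<noteq> v1"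
    unfolding vec_eq_iff U_all co using nz sum0 by (auto; linarith)+
  have neg: "- x \<notin> {v, v1, v2}" if "x \<in> {v, v1, v2}" for x
    using that nz unfolding insert_iff vec_eq_iff U_all by (auto simp: co)
  have "independent {v, v1, v2}"
    using v max neg by (intro maximal_independent) auto
  moreover have eq: "- v - v1 = v2"
    unfolding vec_eq_iff U_all using sum0 by (simp add: co)
  have "- v - v1 \<in> span ({v, v1, v2} - {v2})"
    using ne by (intro span_diff span_neg span_base) blast+
  then have "v2 \<in> span ({v, v1, v2} - {v2})"
    by (simp only: eq)
  ultimately show False
    unfolding dependent_def by blast
qed

section \<open>Exclusion of the dimensions\<close>

lemma exists_not_in_list:
  assumes "length xs < CARD('n)"
  shows "\<exists>m::'n. m \<notin> set xs"
proof (rule ccontr)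
  assume "\<not> ?thesis"
  then have "set xs = UNIV"
    by blast
  then show False
    using assms card_length[of xs] by simp
qed

lemma card_not_3_or_ge_5: "\<not> (CARD('n) = 3 \<or> CARD('n) \<ge> 5)"
proof
  assume "CARD('n) = 3 \<or> CARD('n) \<ge> 5"
  then consider "CARD('n) = 3" | "CARD('n) \<ge> 5"
    by blast
  then show False
  proof cases
    case 1
    then obtain i j k :: 'n where "UNIV = {i, j, k}" "distinct [i, j, k]"
      by (auto simp: card_3_iff)
    then show False
      using exists_maximal maximal_cyclic by blast
  next
    case 2
    obtain v where v: "maximal v"
      using exists_maximal by blast
    have two: "\<exists>j. j \<noteq> i \<and> v $ j \<noteq> c" for i c
      using maximal_not_two_valued[OF _ v] 2 by force
    obtain i j k l where ijkl: "distinct [i, j, k, l]" "v $ i \<noteq> v $ j" "v $ k \<noteq> v $ l"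
    proof -
      fix i :: 'n
      obtain j where j: "j \<noteq> i" "v $ j \<noteq> v $ i"
        using two by blast
      show thesis
      proof (cases "\<exists>k l. k \<notin> {i, j} \<and> l \<notin> {i, j} \<and> v $ k \<noteq> v $ l")
        case True
        then obtain k l where "k \<notin> {i, j}" "l \<notin> {i, j}" "v $ k \<noteq> v $ l"
          by blast
        then show thesis
          using that[of i j k l] j by auto
      next
        \<comment> \<open>All coordinates outside \<open>i, j\<close> are equal, and neither
          \<open>v $ i\<close> nor \<open>v $ j\<close> may agree with them, since \<open>v\<close>
          would then be constant off a single coordinate. So \<open>i\<close> is paired with
          \<open>k\<close>, and \<open>j\<close> with \<open>l\<close>.\<close>
        case False
        obtain k where k: "k \<notin> {i, j}"
          using exists_not_in_list[of "[i, j]"] 2 by auto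
        obtain l where l: "l \<notin> {i, j, k}"
          using exists_not_in_list[of "[i, j, k]"] 2 by auto
        have const: "v $ n = v $ k" if "n \<notin> {i, j}" for n
          using False k that by blast
        have "v $ i \<noteq> v $ k"
          using two[of j "v $ k"] const by (metis empty_iff insert_iff)
        moreover have "v $ j \<noteq> v $ l"
          using two[of i "v $ k"] const l by (metis empty_iff insert_iff)
        ultimately show thesis
          using that[of i k j l] k l j(1) by auto
      qed
    qed
    obtain m where m: "m \<notin> {i, j, k, l}"
      using exists_not_in_list[of "[i, j, k, l]"] 2 by auto
    \<comment> \<open>In the second list \<open>j\<close> and \<open>m\<close> exchange roles. The
      first application forces \<open>v $ m = 0\<close> and \<open>v $ i = - v $ j\<close>, so
      \<open>v $ i\<close> is nonzero and differs from both \<open>v $ m\<close> and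
      \<open>- v $ m\<close>.\<close>
    then have dist: "distinct [i, j, k, l, m]" "distinct [i, m, k, l, j]"
      using ijkl(1) by auto
    have *: "v $ m = 0" "v $ i = - v $ j"
      using maximal_four_point[OF v dist(1) ijkl(2,3)] by blast+
    then have "v $ i \<noteq> v $ m" "v $ i \<noteq> - v $ m"
      using ijkl(2) by auto
    then show False
      using maximal_four_point[OF v dist(2) _ ijkl(3)] by blast
  qed
qed

end

section \<open>Asymptotic seminorms\<close>

text \<open>Fekete's lemma for a real parameter; boundedness on bounded intervals controls the
  remainder of the division by \<open>s0\<close>.\<close>

lemma subadditive_real_limit:
  fixes h :: "real \<Rightarrow> real"
  assumes nonneg: "\<And>s. s > 0 \<Longrightarrow> h s \<ge> 0"
    and add: "\<And>s t. \<lbrakk>s > 0; t > 0\<rbrakk> \<Longrightarrow> h (s + t) \<le> h s + h t"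
    and bdd: "\<And>a. \<exists>K. \<forall>s. 0 < s \<and> s \<le> a \<longrightarrow> h s \<le> K"
  shows "((\<lambda>s. h s / s) \<longlongrightarrow> (INF s\<in>{0<..}. h s / s)) at_top"
proof -
  define L where "L = (INF s\<in>{0<..}. h s / s)"
  have bb: "bdd_below ((\<lambda>s. h s / s) ` {0<..})"
    using nonneg by (intro bdd_belowI2[where m = 0]) auto
  have L_le: "L \<le> h s / s" if "s > 0" for s
    unfolding L_def using that by (intro cINF_lower[OF bb]) auto
  have mult: "h (real q * s + r) \<le> real q * h s + h r" if "s > 0" "r > 0" for q s r
  proof (induction q)
    case (Suc q)
    have "real q * s + r > 0"
      using that by (simp add: add_nonneg_pos)
    then have "h (real (Suc q) * s + r) \<le> h s + h (real q * s + r)"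
      using add[of s "real q * s + r"] that by (simp add: algebra_simps)
    then show ?case
      using Suc by (simp add: algebra_simps)
  qed simp
  have "((\<lambda>s. h s / s) \<longlongrightarrow> L) at_top"
  proof (rule order_tendstoI)
    fix a assume "a < L"
    then have "a < h s / s" if "s > 0" for s
      using L_le[OF that] by linarith
    then show "\<forall>\<^sub>F s in at_top. a < h s / s"
      by (rule eventually_mono[OF eventually_gt_at_top])
  next
    fix a assume "L < a"
    then obtain s0 where s0: "s0 > 0" "h s0 / s0 < a"
      unfolding L_def using cINF_less_iff[OF _ bb] by auto
    obtain K where K: "\<And>s. \<lbrakk>0 < s; s \<le> s0\<rbrakk> \<Longrightarrow> h s \<le> K"
      using bdd by meson
    have bound: "h s / s \<le> h s0 / s0 + K / s" if s: "s > 0" for s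
    proof -
      \<comment> \<open>Rounding up and subtracting 1, instead of rounding down, puts the remainder
        \<open>r\<close> into the interval from 0 (excluded) to \<open>s0\<close> (included), so
        that it is positive as the hypotheses require.\<close>
      define q where "q = nat (\<lceil>s / s0\<rceil> - 1)"
      define r where "r = s - real q * s0"
      have "\<lceil>s / s0\<rceil> \<ge> 1"
        using s s0(1) by simp
      then have q: "real q = of_int \<lceil>s / s0\<rceil> - 1"
        by (simp add: q_def)
      then have "real q < s / s0" "s / s0 \<le> real q + 1"
        using ceiling_correct[of "s / s0"] by linarith+
      then have qs: "real q * s0 < s" "s \<le> real q * s0 + s0"
        using s0(1) by (simp_all add: field_simps)
      then have r: "0 < r" "r \<le> s0"
        by (simp_all add: r_def)
      have "h s \<le> real q * h s0 + h r"
        using mult[OF s0(1) r(1), of q] by (simp add: r_def)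
      also have "\<dots> \<le> s / s0 * h s0 + K"
        using K[OF r] \<open>real q < s / s0\<close> nonneg[OF s0(1)] by (intro add_mono mult_right_mono) auto
      finally have "h s / s \<le> (s / s0 * h s0 + K) / s"
        using s by (intro divide_right_mono) auto
      then show ?thesis
        using s by (simp add: add_divide_distrib)
    qed
    have "((\<lambda>s. h s0 / s0 + K / s) \<longlongrightarrow> h s0 / s0 + 0) at_top"
      by (intro tendsto_intros tendsto_divide_0[OF tendsto_const] filterlim_at_top_imp_at_infinity filterlim_ident)
    then have "\<forall>\<^sub>F s in at_top. h s0 / s0 + K / s < a"
      using s0(2) by (intro order_tendstoD(2)) auto
    then show "\<forall>\<^sub>F s in at_top. h s / s < a"
      using eventually_gt_at_top[of 0]
    proof eventually_elim
      case (elim s)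
      then show ?case
        using bound[of s] by linarith
    qed
  qed
  then show ?thesis
    by (simp add: L_def)
qed

text \<open>The properties of the displacement of a base point under the torus. Permutations act up
  to an additive constant because they move the base point, and properness speaks of coordinate
  differences because constant vectors act trivially.\<close>

locale symmetric_coarsely_hyperconvex =
  fixes \<rho> :: "int ^ 'n::finite \<Rightarrow> real" and R :: real
  assumes nonneg: "\<rho> m \<ge> 0"
    and minus: "\<rho> (- m) = \<rho> m"
    and add: "\<rho> (m + m') \<le> \<rho> m + \<rho> m'"
    and const: "\<rho> (\<chi> i. k) = 0"
    and permute: "p permutes UNIV \<Longrightarrow> \<exists>C. \<forall>m. \<rho> (\<chi> i. m $ p i) \<le> \<rho> m + C"
    and proper: "\<exists>C. \<forall>m. \<rho> m \<le> r \<longrightarrow> real_of_int (m $ i - m $ j) \<le> C"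
    and R_nonneg: "R \<ge> 0"
    and balls: "\<lbrakk>finite B; \<And>m r. (m, r) \<in> B \<Longrightarrow> r \<ge> 0;
        \<And>m r m' r'. \<lbrakk>(m, r) \<in> B; (m', r') \<in> B\<rbrakk> \<Longrightarrow> \<rho> (m - m') \<le> r + r'\<rbrakk>
      \<Longrightarrow> \<exists>k. \<forall>(m, r)\<in>B. \<rho> (k - m) \<le> r + R"
begin

lemma finite_bounded: "finite {m :: int ^ 'n. \<forall>i. \<bar>m $ i\<bar> \<le> b}"
proof -
  have "{m :: int ^ 'n. \<forall>i. \<bar>m $ i\<bar> \<le> b} \<subseteq> vec_lambda ` (UNIV \<rightarrow>\<^sub>E {- b..b})"
  proof
    fix m :: "int ^ 'n"
    assume "m \<in> {m. \<forall>i. \<bar>m $ i\<bar> \<le> b}"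
    then have "vec_nth m \<in> UNIV \<rightarrow>\<^sub>E {- b..b}"
      by (auto simp: abs_le_iff) (metis minus_le_iff)
    then show "m \<in> vec_lambda ` (UNIV \<rightarrow>\<^sub>E {- b..b})"
      by (metis image_eqI vec_nth_inverse)
  qed
  then show ?thesis
    by (rule finite_subset) (intro finite_imageI finite_PiE; simp)
qed

definition gap :: real
  where "gap = Max (\<rho> ` {m. \<forall>i. \<bar>m $ i\<bar> \<le> 1})"

lemma \<rho>_le_gap: "(\<And>i. \<bar>m $ i\<bar> \<le> 1) \<Longrightarrow> \<rho> m \<le> gap"
  unfolding gap_def by (intro Max_ge finite_imageI finite_bounded) auto

lemma gap_nonneg: "gap \<ge> 0"
  using \<rho>_le_gap[of 0] nonneg[of 0] by simp

lemma \<rho>_le_add_gap: "(\<And>i. \<bar>m $ i - m' $ i\<bar> \<le> 1) \<Longrightarrow> \<rho> m \<le> \<rho> m' + gap"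
  using add[of m' "m - m'"] \<rho>_le_gap[of "m - m'"] by simp

definition fl :: "real ^ 'n \<Rightarrow> int ^ 'n"
  where "fl x = (\<chi> i. \<lfloor>x $ i\<rfloor>)"

text \<open>Rounding a sum differs from summing the rounded vectors by at most 1 in each coordinate.
  Adding \<open>gap\<close> absorbs this and makes \<open>\<rho>'\<close> exactly
  subadditive.\<close>

definition \<rho>' :: "real ^ 'n \<Rightarrow> real"
  where "\<rho>' x = \<rho> (fl x) + gap"

definition asym :: "real ^ 'n \<Rightarrow> real"
  where "asym x = (INF s\<in>{0<..}. \<rho>' (s *\<^sub>R x) / s)"

lemma \<rho>'_nonneg: "\<rho>' x \<ge> 0"
  using nonneg gap_nonneg by (simp add: \<rho>'_def add_nonneg_nonneg)

lemma \<rho>'_add: "\<rho>' (x + y) \<le> \<rho>' x + \<rho>' y"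
proof -
  have "\<bar>fl (x + y) $ i - (fl x + fl y) $ i\<bar> \<le> 1" for i
    by (simp add: fl_def) linarith
  then have "\<rho> (fl (x + y)) \<le> \<rho> (fl x + fl y) + gap"
    by (rule \<rho>_le_add_gap)
  then show ?thesis
    using add[of "fl x" "fl y"] by (simp add: \<rho>'_def)
qed

lemma asym_tendsto: "((\<lambda>s. \<rho>' (s *\<^sub>R x) / s) \<longlongrightarrow> asym x) at_top"
  unfolding asym_def
proof (rule subadditive_real_limit)
  show "\<rho>' ((s + t) *\<^sub>R x) \<le> \<rho>' (s *\<^sub>R x) + \<rho>' (t *\<^sub>R x)" for s t
    by (simp add: scaleR_add_left \<rho>'_add)
  show "\<exists>K. \<forall>s. 0 < s \<and> s \<le> a \<longrightarrow> \<rho>' (s *\<^sub>R x) \<le> K" for a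
  proof (intro exI allI impI)
    fix s assume s: "0 < s \<and> s \<le> a"
    define b where "b = \<lceil>a * norm x\<rceil> + 1"
    have "\<bar>fl (s *\<^sub>R x) $ i\<bar> \<le> b" for i
    proof -
      have "\<bar>s * x $ i\<bar> \<le> a * norm x"
        using s component_le_norm_cart[of x i] by (auto simp: abs_mult intro!: mult_mono)
      then show ?thesis
        by (simp add: fl_def b_def) linarith
    qed
    then have "\<rho> (fl (s *\<^sub>R x)) \<le> Max (\<rho> ` {m. \<forall>i. \<bar>m $ i\<bar> \<le> b})"
      by (intro Max_ge finite_imageI finite_bounded) auto
    then show "\<rho>' (s *\<^sub>R x) \<le> Max (\<rho> ` {m. \<forall>i. \<bar>m $ i\<bar> \<le> b}) + gap"
      by (simp add: \<rho>'_def)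
  qed
qed (rule \<rho>'_nonneg)

lemma asym_le:
  assumes "s > 0"
  shows "asym x \<le> \<rho>' (s *\<^sub>R x) / s"
  unfolding asym_def
  using assms \<rho>'_nonneg by (intro cINF_lower bdd_belowI2[where m = 0]) auto

text \<open>An additive constant disappears after division by \<open>s\<close>.\<close>

lemma asym_mono:
  assumes "\<And>s. s > 0 \<Longrightarrow> \<rho> (fl (s *\<^sub>R x)) \<le> \<rho> (fl (s *\<^sub>R y)) + C"
  shows "asym x \<le> asym y"
proof (rule tendsto_le[OF trivial_limit_at_top_linorder _ asym_tendsto])
  have "((\<lambda>s. \<rho>' (s *\<^sub>R y) / s + C / s) \<longlongrightarrow> asym y + 0) at_top"
    by (intro tendsto_intros asym_tendsto tendsto_divide_0[OF tendsto_const]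
        filterlim_at_top_imp_at_infinity filterlim_ident)
  then show "((\<lambda>s. \<rho>' (s *\<^sub>R y) / s + C / s) \<longlongrightarrow> asym y) at_top"
    by simp
  have "\<rho>' (s *\<^sub>R x) / s \<le> \<rho>' (s *\<^sub>R y) / s + C / s" if "s > 0" for s
    using assms[OF that] that by (simp add: \<rho>'_def divide_right_mono flip: add_divide_distrib)
  then show "\<forall>\<^sub>F s in at_top. \<rho>' (s *\<^sub>R x) / s \<le> \<rho>' (s *\<^sub>R y) / s + C / s"
    by (rule eventually_mono[OF eventually_gt_at_top])
qed

text \<open>Cutting off pieces of length \<open>2 R + 1\<close> from \<open>m\<close> leaves a vector that is shorter by \<open>1\<close>.\<close>

lemma linear_growth: "\<exists>C>0. \<forall>m. real_of_int (m $ i - m $ j) \<le> C * (\<rho> m + 2)"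
proof -
  obtain C0 where C0: "\<And>m. \<rho> m \<le> 2 * R + 1 \<Longrightarrow> real_of_int (m $ i - m $ j) \<le> C0"
    using proper by meson
  define C where "C = max C0 1"
  have C: "\<And>m. \<rho> m \<le> 2 * R + 1 \<Longrightarrow> real_of_int (m $ i - m $ j) \<le> C" "C > 0"
    using C0 by (force simp: C_def)+
  have steps: "real_of_int (m $ i - m $ j) \<le> C * (real k + 1)"
    if "\<rho> m \<le> 2 * R + 1 + real k" for k m
    using that
  proof (induction k arbitrary: m)
    case 0
    then show ?case
      using C(1)[of m] by simp
  next
    case (Suc k)
    show ?case
    proof (cases "\<rho> m \<le> 2 * R + 1")
      case True
      have "C \<le> C * (real (Suc k) + 1)"
        using C(2) by simp
      then show ?thesis
        using C(1)[OF True] by linarith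
    next
      case False
      have zero: "\<rho> 0 = 0"
        using const[of 0] by (simp add: zero_vec_def)
      \<comment> \<open>The radii \<open>R + 1\<close> around \<open>0\<close> and \<open>r\<close>
        around \<open>m\<close> add up to \<open>\<rho> m\<close>. A coarse common point
        \<open>l\<close> has \<open>\<rho> l <= 2 * R + 1\<close>, and \<open>m - l\<close> has
        length at most \<open>\<rho> m - 1\<close>.\<close>
      define r where "r = \<rho> m - R - 1"
      have r: "r \<ge> 0"
        using False R_nonneg by (simp add: r_def)
      have "\<exists>l. \<forall>(n, r)\<in>{(0, R + 1), (m, r)}. \<rho> (l - n) \<le> r + R"
        using r R_nonneg zero minus[of m] by (intro balls) (auto simp: r_def)
      then obtain l where l: "\<rho> l \<le> 2 * R + 1" "\<rho> (l - m) \<le> r + R"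
        by auto
      have "\<rho> (m - l) \<le> 2 * R + 1 + real k"
        using l(2) Suc.prems minus[of "m - l"] R_nonneg by (simp add: r_def)
      then have "real_of_int ((m - l) $ i - (m - l) $ j) \<le> C * (real k + 1)"
        by (rule Suc.IH)
      then show ?thesis
        using C(1)[OF l(1)] by (simp add: algebra_simps)
    qed
  qed
  have "real_of_int (m $ i - m $ j) \<le> C * (\<rho> m + 2)" for m
  proof -
    define k where "k = nat \<lceil>\<rho> m\<rceil>"
    have k: "\<rho> m \<le> real k" "real k \<le> \<rho> m + 1"
      using nonneg[of m] by (simp_all add: k_def)
    then have "real_of_int (m $ i - m $ j) \<le> C * (real k + 1)"
      using R_nonneg by (intro steps) simp
    also have "\<dots> \<le> C * (\<rho> m + 2)"
      using k C(2) by simp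
    finally show ?thesis .
  qed
  then show ?thesis
    using C(2) by blast
qed

lemma asym_pos:
  assumes "i \<noteq> j"
  shows "asym (axis i 1) > 0"
proof -
  obtain C where C: "C > 0" "\<And>m. real_of_int (m $ i - m $ j) \<le> C * (\<rho> m + 2)"
    using linear_growth by blast
  have "1 / C \<le> asym (axis i 1)"
  proof (rule tendsto_le[OF trivial_limit_at_top_linorder asym_tendsto])
    have "((\<lambda>s. 1 / C - (1 / C + 2) / s) \<longlongrightarrow> 1 / C - 0) at_top"
      by (intro tendsto_intros tendsto_divide_0[OF tendsto_const]
          filterlim_at_top_imp_at_infinity filterlim_ident)
    then show "((\<lambda>s. 1 / C - (1 / C + 2) / s) \<longlongrightarrow> 1 / C) at_top"
      by simp
    have "1 / C - (1 / C + 2) / s \<le> \<rho>' (s *\<^sub>R axis i 1) / s" if "s > 0" for s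
    proof -
      have "s - 1 \<le> C * (\<rho>' (s *\<^sub>R axis i 1) + 2)"
      proof -
        have "s - 1 \<le> real_of_int (fl (s *\<^sub>R axis i 1) $ i - fl (s *\<^sub>R axis i 1) $ j)"
          using assms by (simp add: fl_def axis_def)
        also have "\<dots> \<le> C * (\<rho> (fl (s *\<^sub>R axis i 1)) + 2)"
          by (rule C(2))
        also have "\<dots> \<le> C * (\<rho>' (s *\<^sub>R axis i 1) + 2)"
          using C(1) gap_nonneg by (simp add: \<rho>'_def)
        finally show ?thesis .
      qed
      then have "(s - 1) / C - 2 \<le> \<rho>' (s *\<^sub>R axis i 1)"
        using C(1) by (simp add: pos_divide_le_eq mult.commute diff_le_eq)
      then have "((s - 1) / C - 2) / s \<le> \<rho>' (s *\<^sub>R axis i 1) / s"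
        using that by (intro divide_right_mono) auto
      moreover have "((s - 1) / C - 2) / s = 1 / C - (1 / C + 2) / s"
        using C(1) that by (simp add: field_simps)
      ultimately show ?thesis
        by simp
    qed
    then show "\<forall>\<^sub>F s in at_top. 1 / C - (1 / C + 2) / s \<le> \<rho>' (s *\<^sub>R axis i 1) / s"
      by (rule eventually_mono[OF eventually_gt_at_top])
  qed
  then show ?thesis
    using C(1) by (meson less_le_trans zero_less_divide_1_iff)
qed

text \<open>The balls are enlarged by a factor \<open>s\<close>, rounded to the lattice, intersected
  there with error \<open>R\<close>, and scaled back; for large \<open>s\<close> all errors become
  small.\<close>

lemma asym_balls:
  assumes B: "finite B" "\<And>x r y r'. \<lbrakk>(x, r) \<in> B; (y, r') \<in> B\<rbrakk> \<Longrightarrow> asym (x - y) \<le> r + r'"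
    and \<epsilon>: "\<epsilon> > 0"
  shows "\<exists>z. \<forall>(x, r)\<in>B. asym (z - x) \<le> r + \<epsilon>"
proof -
  \<comment> \<open>One \<open>\<delta>\<close> pays for replacing \<open>asym\<close> by its value
    at scale \<open>s\<close>, a second one for \<open>R\<close> and two roundings;
    \<open>2 * \<delta>\<close> stays below \<open>\<epsilon>\<close>.\<close>
  define \<delta> where "\<delta> = \<epsilon> / 4"
  have \<delta>: "\<delta> > 0"
    using \<epsilon> by (simp add: \<delta>_def)
  have "\<forall>\<^sub>F s in at_top. \<forall>p\<in>B. \<forall>q\<in>B. \<rho>' (s *\<^sub>R (fst p - fst q)) / s < asym (fst p - fst q) + \<delta>"
    using B(1) \<delta> by (intro eventually_ball_finite ballI order_tendstoD(2)[OF asym_tendsto]) auto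
  moreover have "\<forall>\<^sub>F s in at_top. s \<ge> (R + 2 * gap) / \<delta>"
    by (rule eventually_ge_at_top)
  moreover have "\<forall>\<^sub>F s in at_top. s > (0 :: real)"
    by (rule eventually_gt_at_top)
  ultimately have "\<forall>\<^sub>F s in at_top. s > 0 \<and> s \<ge> (R + 2 * gap) / \<delta> \<and>
      (\<forall>p\<in>B. \<forall>q\<in>B. \<rho>' (s *\<^sub>R (fst p - fst q)) / s < asym (fst p - fst q) + \<delta>)"
    by eventually_elim auto
  then obtain s where s: "s > 0" "s \<ge> (R + 2 * gap) / \<delta>"
    and lt: "\<And>p q. \<lbrakk>p \<in> B; q \<in> B\<rbrakk> \<Longrightarrow> \<rho>' (s *\<^sub>R (fst p - fst q)) / s < asym (fst p - fst q) + \<delta>"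
    by (metis (no_types, lifting) eventually_happens trivial_limit_at_top_linorder)
  define B' where "B' = (\<lambda>(x, r). (fl (s *\<^sub>R x), s * (r + \<delta>))) ` B"
  have "\<exists>k. \<forall>(m, r)\<in>B'. \<rho> (k - m) \<le> r + R"
  proof (rule balls)
    show "finite B'"
      using B(1) by (simp add: B'_def)
  next
    fix m r assume "(m, r) \<in> B'"
    then obtain x r0 where x: "(x, r0) \<in> B" "r = s * (r0 + \<delta>)"
      by (auto simp: B'_def)
    have "0 \<le> asym (x - x)"
      unfolding asym_def using \<rho>'_nonneg by (intro cINF_greatest) auto
    then have "r0 \<ge> 0"
      using B(2)[OF x(1) x(1)] by linarith
    then show "r \<ge> 0"
      using s(1) \<delta> x(2) by simp
  next
    fix m r m' r' assume "(m, r) \<in> B'" "(m', r') \<in> B'"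
    then obtain x r0 y r1 where x: "(x, r0) \<in> B" "m = fl (s *\<^sub>R x)" "r = s * (r0 + \<delta>)"
      and y: "(y, r1) \<in> B" "m' = fl (s *\<^sub>R y)" "r' = s * (r1 + \<delta>)"
      by (auto simp: B'_def)
    have "\<bar>(m - m') $ i - fl (s *\<^sub>R (x - y)) $ i\<bar> \<le> 1" for i
      by (simp add: x y fl_def right_diff_distrib) linarith
    then have "\<rho> (m - m') \<le> \<rho>' (s *\<^sub>R (x - y))"
      unfolding \<rho>'_def by (rule \<rho>_le_add_gap)
    also have "\<dots> \<le> s * (asym (x - y) + \<delta>)"
      using lt[OF x(1) y(1)] s(1) by (simp add: pos_divide_less_eq mult.commute less_imp_le)
    also have "\<dots> \<le> s * (r0 + r1 + \<delta>)"
      using B(2)[OF x(1) y(1)] s(1) by simp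
    also have "\<dots> \<le> r + r'"
      using s(1) \<delta> by (simp add: x y algebra_simps)
    finally show "\<rho> (m - m') \<le> r + r'" .
  qed
  then obtain k where k: "\<And>x r. (x, r) \<in> B \<Longrightarrow> \<rho> (k - fl (s *\<^sub>R x)) \<le> s * (r + \<delta>) + R"
    by (fastforce simp: B'_def)
  define z :: "real ^ 'n" where "z = (1 / s) *\<^sub>R (\<chi> i. real_of_int (k $ i))"
  have "asym (z - x) \<le> r + \<epsilon>" if xr: "(x, r) \<in> B" for x r
  proof -
    have "s *\<^sub>R (z - x) = (\<chi> i. real_of_int (k $ i)) - s *\<^sub>R x"
      using s(1) by (simp add: z_def scaleR_diff_right)
    then have "\<bar>fl (s *\<^sub>R (z - x)) $ i - (k - fl (s *\<^sub>R x)) $ i\<bar> \<le> 1" for i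
      by (simp add: fl_def) linarith
    then have "\<rho> (fl (s *\<^sub>R (z - x))) \<le> \<rho> (k - fl (s *\<^sub>R x)) + gap"
      by (rule \<rho>_le_add_gap)
    then have "\<rho>' (s *\<^sub>R (z - x)) \<le> s * (r + \<delta>) + (R + 2 * gap)"
      using k[OF xr] by (simp add: \<rho>'_def)
    also have "R + 2 * gap \<le> s * \<delta>"
      using s(2) \<delta> by (simp add: pos_divide_le_eq)
    finally have "\<rho>' (s *\<^sub>R (z - x)) \<le> (r + 2 * \<delta>) * s"
      by (simp add: algebra_simps)
    then have "\<rho>' (s *\<^sub>R (z - x)) / s \<le> r + 2 * \<delta>"
      using s(1) by (simp add: pos_divide_le_eq)
    then show ?thesis
      using asym_le[OF s(1), of "z - x"] \<epsilon> by (simp add: \<delta>_def)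
  qed
  then show ?thesis
    by blast
qed

lemma asym_seminorm:
  assumes "CARD('n) \<ge> 2"
  shows "symmetric_hyperconvex_seminorm asym"
proof
  show "asym (x + y) \<le> asym x + asym y" for x y
  proof (rule tendsto_le[OF trivial_limit_at_top_linorder _ asym_tendsto])
    show "((\<lambda>s. \<rho>' (s *\<^sub>R x) / s + \<rho>' (s *\<^sub>R y) / s) \<longlongrightarrow> asym x + asym y) at_top"
      by (intro tendsto_add asym_tendsto)
    have "\<rho>' (s *\<^sub>R (x + y)) / s \<le> \<rho>' (s *\<^sub>R x) / s + \<rho>' (s *\<^sub>R y) / s" if "s > 0" for s
      using that \<rho>'_add[of "s *\<^sub>R x" "s *\<^sub>R y"]
      by (simp add: scaleR_add_right divide_right_mono flip: add_divide_distrib)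
    then show "\<forall>\<^sub>F s in at_top. \<rho>' (s *\<^sub>R (x + y)) / s \<le> \<rho>' (s *\<^sub>R x) / s + \<rho>' (s *\<^sub>R y) / s"
      by (rule eventually_mono[OF eventually_gt_at_top])
  qed
  have pos_scale: "asym (t *\<^sub>R x) = t * asym x" if t: "t > 0" for t x
  proof -
    have "((\<lambda>s. \<rho>' ((s * t) *\<^sub>R x) / (s * t)) \<longlongrightarrow> asym x) at_top"
      by (rule filterlim_compose[OF asym_tendsto])
        (intro filterlim_at_top_mult_tendsto_pos[OF tendsto_const t] filterlim_ident)
    then have "((\<lambda>s. t * (\<rho>' ((s * t) *\<^sub>R x) / (s * t))) \<longlongrightarrow> t * asym x) at_top"
      by (rule tendsto_mult_left)
    then have "((\<lambda>s. \<rho>' (s *\<^sub>R (t *\<^sub>R x)) / s) \<longlongrightarrow> t * asym x) at_top"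
      using t by simp
    then show ?thesis
      using tendsto_unique[OF trivial_limit_at_top_linorder asym_tendsto] by blast
  qed
  show "asym (t *\<^sub>R x) = t * asym x" if "t \<ge> 0" for t x
    using pos_scale[of t x] pos_scale[of 2 "0 :: real ^ 'n"] that by (cases "t = 0") auto
  have minus_le: "asym (- x) \<le> asym x" for x
  proof (rule asym_mono)
    fix s :: real assume "s > 0"
    have "\<bar>fl (s *\<^sub>R - x) $ i - (- fl (s *\<^sub>R x)) $ i\<bar> \<le> 1" for i
      by (simp add: fl_def) linarith
    then show "\<rho> (fl (s *\<^sub>R - x)) \<le> \<rho> (fl (s *\<^sub>R x)) + gap"
      using \<rho>_le_add_gap minus by metis
  qed
  show "asym (- x) = asym x" for x
    using minus_le[of x] minus_le[of "- x"] by simp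
  have zero: "asym 0 = 0"
    using pos_scale[of 2 "0 :: real ^ 'n"] by simp
  have "asym 1 \<le> asym 0"
  proof (rule asym_mono)
    fix s :: real
    have "fl (s *\<^sub>R 1) = (\<chi> i. \<lfloor>s\<rfloor>)"
      by (simp add: fl_def)
    then show "\<rho> (fl (s *\<^sub>R 1)) \<le> \<rho> (fl (s *\<^sub>R 0)) + 0"
      by (simp add: const nonneg)
  qed
  moreover have "0 \<le> asym 1"
    unfolding asym_def using \<rho>'_nonneg by (intro cINF_greatest) auto
  ultimately show "asym 1 = 0"
    using zero by simp
  have perm_le: "asym (\<chi> i. x $ p i) \<le> asym x" if p: "p permutes UNIV" for p x
  proof -
    obtain C where C: "\<And>m. \<rho> (\<chi> i. m $ p i) \<le> \<rho> m + C"
      using permute[OF p] by blast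
    show ?thesis
    proof (rule asym_mono)
      fix s :: real
      have "fl (s *\<^sub>R (\<chi> i. x $ p i)) = (\<chi> i. fl (s *\<^sub>R x) $ p i)"
        by (simp add: fl_def vec_eq_iff)
      then show "\<rho> (fl (s *\<^sub>R (\<chi> i. x $ p i))) \<le> \<rho> (fl (s *\<^sub>R x)) + C"
        using C by simp
    qed
  qed
  show "asym (\<chi> i. x $ p i) = asym x" if p: "p permutes UNIV" for p x
  proof (rule antisym[OF perm_le[OF p]])
    have "(\<chi> i. (\<chi> i. x $ p i) $ inv_into UNIV p i) = x"
      using permutes_inverses(1)[OF p] by (simp add: vec_eq_iff)
    then show "asym x \<le> asym (\<chi> i. x $ p i)"
      using perm_le[OF permutes_inv[OF p], of "\<chi> i. x $ p i"] by simp
  qed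
  show "\<exists>x. asym x > 0"
  proof -
    obtain i j :: 'n where "i \<noteq> j"
      using assms by (metis card_2_iff' card_le_Suc0_iff_eq finite numeral_2_eq_2 not_less_eq_eq UNIV_I)
    then show ?thesis
      using asym_pos by blast
  qed
qed (rule asym_balls)

lemma card_not_3_or_ge_5: "\<not> (CARD('n) = 3 \<or> CARD('n) \<ge> 5)"
proof
  assume card: "CARD('n) = 3 \<or> CARD('n) \<ge> 5"
  then have "symmetric_hyperconvex_seminorm asym"
    by (intro asym_seminorm) auto
  then show False
    using card symmetric_hyperconvex_seminorm.card_not_3_or_ge_5 by blast
qed

end

section \<open>Matrices over a local field\<close>

lemma continuous_on_det: "continuous_on UNIV (det :: 'k::local_field ^ 'n ^ 'n \<Rightarrow> 'k)"
proof -
  have "continuous_on UNIV (\<lambda>A :: 'k ^ 'n ^ 'n. A $ i $ j)" for i j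
    by (auto simp: continuous_on_def intro!: tendsto_intros)
  then show ?thesis
    unfolding det_def by (intro continuous_on_sum continuous_on_mult' continuous_on_prod' continuous_on_const)
qed

lemma absval_matrix_le_dist: "absval (A $ i $ j) \<le> dist A (0 :: 'k::local_field ^ 'n ^ 'm)"
proof -
  have "absval (A $ i $ j) = dist (A $ i $ j) (0 $ i $ j)"
    by (simp add: dist_absval)
  also have "\<dots> \<le> dist (A $ i) (0 $ i)"
    by (rule dist_vec_nth_le)
  also have "\<dots> \<le> dist A 0"
    by (rule dist_vec_nth_le)
  finally show ?thesis .
qed

lemma dist_matrix_le_sum: "dist A (0 :: 'k::local_field ^ 'n ^ 'm) \<le> (\<Sum>i\<in>UNIV. \<Sum>j\<in>UNIV. absval (A $ i $ j))"
proof -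
  have "dist A 0 \<le> (\<Sum>i\<in>UNIV. dist (A $ i) (0 $ i))"
    unfolding dist_vec_def[of A] by (rule L2_set_le_sum) simp
  also have "\<dots> \<le> (\<Sum>i\<in>UNIV. \<Sum>j\<in>UNIV. dist (A $ i $ j) (0 $ i $ j))"
  proof (rule sum_mono)
    show "dist (A $ i) (0 $ i) \<le> (\<Sum>j\<in>UNIV. dist (A $ i $ j) (0 $ i $ j))" for i
      unfolding dist_vec_def[of "A $ i"] by (rule L2_set_le_sum) simp
  qed
  finally show ?thesis
    by (simp add: dist_absval)
qed

lemma compact_bounded_det_1:
  "compact {A :: 'k::local_field ^ 'n ^ 'n. det A = 1 \<and> (\<forall>i j. absval (A $ i $ j) \<le> C)}"
    (is "compact ?K")
  unfolding compact_eq_bounded_closed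
proof
  have "dist 0 A \<le> real CARD('n) * (real CARD('n) * C)" if "A \<in> ?K" for A
  proof -
    have "(\<Sum>i\<in>UNIV. \<Sum>j\<in>UNIV. absval (A $ i $ j)) \<le> (\<Sum>i\<in>(UNIV :: 'n set). \<Sum>j\<in>(UNIV :: 'n set). C)"
      using that by (intro sum_mono) auto
    then show ?thesis
      using dist_matrix_le_sum[of A] by (simp add: dist_commute[of 0])
  qed
  then show "bounded ?K"
    unfolding bounded_any_center[where a = 0] by blast
  have "continuous_on UNIV (\<lambda>A :: 'k ^ 'n ^ 'n. absval (A $ i $ j))" for i j
  proof -
    have "continuous_on UNIV (\<lambda>A :: 'k ^ 'n ^ 'n. dist (A $ i $ j) 0)"
      by (auto simp: continuous_on_def intro!: tendsto_intros)
    then show ?thesis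
      by (simp add: dist_absval)
  qed
  then have "closed {A :: 'k ^ 'n ^ 'n. det A = 1 \<and> (\<forall>i j. absval (A $ i $ j) \<le> C)}"
    by (intro closed_Collect_conj closed_Collect_all closed_Collect_eq closed_Collect_le
        continuous_on_det continuous_on_const)
  then show "closed ?K" .
qed

text \<open>For determinant 1 this bounds the product of the column maxima from below.\<close>

lemma absval_det_le:
  fixes A :: "'k::local_field ^ 'n ^ 'n"
  assumes "\<And>i j. absval (A $ i $ j) \<le> b j"
  shows "absval (det A) \<le> fact CARD('n) * (\<Prod>j\<in>UNIV. b j)"
proof -
  have "absval (det A) \<le> (\<Sum>p | p permutes UNIV. absval (of_int (sign p) * (\<Prod>i\<in>UNIV. A $ i $ p i)))"
    unfolding det_def by (rule absval_sum_le)
  also have "\<dots> \<le> (\<Sum>p | p permutes (UNIV :: 'n set). \<Prod>j\<in>UNIV. b j)"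
  proof (rule sum_mono)
    fix p :: "'n \<Rightarrow> 'n" assume "p \<in> {p. p permutes UNIV}"
    then have "(\<Prod>j\<in>UNIV. b j) = (\<Prod>i\<in>UNIV. b (p i))"
      using prod.permute[of p UNIV b] by (simp add: o_def)
    then show "absval (of_int (sign p) * (\<Prod>i\<in>UNIV. A $ i $ p i)) \<le> (\<Prod>j\<in>UNIV. b j)"
      using assms by (simp add: absval_mult absval_prod prod_mono)
  qed
  also have "\<dots> = fact CARD('n) * (\<Prod>j\<in>UNIV. b j)"
    by (simp add: card_permutations[OF refl finite])
  finally show ?thesis .
qed

section \<open>Diagonal matrices, the torus and sign vectors\<close>

definition diag :: "('n \<Rightarrow> 'k) \<Rightarrow> 'k::local_field ^ 'n ^ 'n"
  where "diag a = (\<chi> i j. if i = j then a i else 0)"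

lemma diag_nth_mult: "(diag a ** B) $ i $ j = a i * B $ i $ j"
proof -
  have "(diag a ** B) $ i $ j = (\<Sum>k\<in>UNIV. if k = i then a i * B $ i $ j else 0)"
    unfolding matrix_matrix_mult_def vec_lambda_beta diag_def by (intro sum.cong) auto
  then show ?thesis
    by simp
qed

lemma mult_diag_nth: "(B ** diag a) $ i $ j = B $ i $ j * a j"
proof -
  have "(B ** diag a) $ i $ j = (\<Sum>k\<in>UNIV. if k = j then B $ i $ j * a j else 0)"
    unfolding matrix_matrix_mult_def vec_lambda_beta diag_def by (intro sum.cong) auto
  then show ?thesis
    by simp
qed

lemma diag_mult: "diag a ** diag b = diag (\<lambda>i. a i * b i)"
  by (simp add: vec_eq_iff diag_nth_mult) (simp add: diag_def)

lemma diag_one: "diag (\<lambda>i. 1) = mat 1"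
  by (simp add: diag_def mat_def)

lemma det_diag: "det (diag a) = (\<Prod>i\<in>UNIV. a i)"
  by (subst det_diagonal) (simp_all add: diag_def)

lemma prod_power_int_sum:
  fixes t :: "'a::field" and f :: "_ \<Rightarrow> int"
  assumes "t \<noteq> 0"
  shows "(\<Prod>i\<in>I. t powi f i) = t powi (\<Sum>i\<in>I. f i)"
  using assms by (induction I rule: infinite_finite_induct) (simp_all add: power_int_add)

text \<open>Subtracting the mean of \<open>CARD('n) * m\<close> gives a diagonal matrix of determinant \<open>1\<close>
  for every integer vector \<open>m\<close>, at the price that constant vectors yield the identity.\<close>

definition torus :: "'k::local_field \<Rightarrow> int ^ 'n::finite \<Rightarrow> 'k ^ 'n ^ 'n"
  where "torus t m = diag (\<lambda>i. t powi (int CARD('n) * m $ i - (\<Sum>j\<in>UNIV. m $ j)))"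

lemma torus_add:
  assumes "t \<noteq> 0"
  shows "torus t (m + m') = torus t (m :: int ^ 'n) ** torus t m'"
  unfolding torus_def diag_mult
proof (intro arg_cong[where f = diag] ext)
  fix i
  have "int CARD('n) * (m + m') $ i - (\<Sum>j\<in>UNIV. (m + m') $ j)
      = (int CARD('n) * m $ i - (\<Sum>j\<in>UNIV. m $ j)) + (int CARD('n) * m' $ i - (\<Sum>j\<in>UNIV. m' $ j))"
    for m m' :: "int ^ 'n"
    by (simp add: sum.distrib distrib_left)
  moreover have "t powi (a + b) = t powi a * t powi b" for a b
    using assms by (simp add: power_int_add)
  ultimately show "t powi (int CARD('n) * (m + m') $ i - (\<Sum>j\<in>UNIV. (m + m') $ j))
      = t powi (int CARD('n) * m $ i - (\<Sum>j\<in>UNIV. m $ j))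
        * t powi (int CARD('n) * m' $ i - (\<Sum>j\<in>UNIV. m' $ j))"
    by (simp only:)
qed

lemma torus_const: "torus t (\<chi> i. k) = mat 1"
  by (simp add: torus_def diag_one)

lemma torus_0: "torus t 0 = mat 1"
  using torus_const[of t 0] by (simp add: zero_vec_def)

lemma det_torus: "t \<noteq> 0 \<Longrightarrow> det (torus t (m :: int ^ 'n)) = 1"
  by (simp add: torus_def det_diag prod_power_int_sum sum_subtractf flip: sum_distrib_left)

text \<open>A permutation matrix has determinant \<open>sign p\<close>. Multiplying one row by this
  sign corrects the determinant, and the diagonal factor commutes with all diagonal
  matrices.\<close>

lemma permutation_normalizes_diag:
  assumes p: "p permutes (UNIV :: 'n::finite set)"
  shows "\<exists>w :: 'k::local_field ^ 'n ^ 'n. det w = 1 \<and> (\<forall>a. w ** diag a = diag (\<lambda>i. a (p i)) ** w)"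
proof -
  fix i0 :: 'n
  define P :: "'k ^ 'n ^ 'n" where "P = (\<chi> i. mat 1 $ p i)"
  define c :: "'n \<Rightarrow> 'k" where "c i = (if i = i0 then of_int (sign p) else 1)" for i
  define w where "w = diag c ** P"
  have "(\<Prod>i\<in>UNIV. c i) = of_int (sign p)"
    by (simp add: c_def)
  moreover have "det P = of_int (sign p)"
    unfolding P_def using det_permute_rows[OF p, of "mat 1 :: 'k ^ 'n ^ 'n"] by simp
  ultimately have "det w = 1"
    by (simp add: w_def det_mul det_diag flip: of_int_mult)
  moreover have "w ** diag a = diag (\<lambda>i. a (p i)) ** w" for a
    by (simp add: vec_eq_iff w_def mult_diag_nth diag_nth_mult P_def mat_def)
  ultimately show ?thesis
    by blast
qed

definition sign_vectors :: "('n \<Rightarrow> 'k::local_field) set"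
  where "sign_vectors = {e. (\<forall>i. e i = 1 \<or> e i = - 1) \<and> (\<Prod>i\<in>UNIV. e i) = 1}"

lemma finite_sign_vectors: "finite (sign_vectors :: ('n::finite \<Rightarrow> 'k::local_field) set)"
proof (rule finite_subset)
  show "sign_vectors \<subseteq> (UNIV :: 'n set) \<rightarrow>\<^sub>E {1, - 1 :: 'k}"
    by (auto simp: sign_vectors_def)
qed (intro finite_PiE; simp)

lemma sign_vectors_one: "(\<lambda>i. 1) \<in> sign_vectors"
  by (simp add: sign_vectors_def)

lemma sign_vectors_mult: "\<lbrakk>e \<in> sign_vectors; e' \<in> sign_vectors\<rbrakk> \<Longrightarrow> (\<lambda>i. e i * e' i) \<in> sign_vectors"
proof -
  assume *: "e \<in> sign_vectors" "e' \<in> sign_vectors"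
  have "e i * e' i = 1 \<or> e i * e' i = - 1" for i
  proof -
    have "e i = 1 \<or> e i = - 1" "e' i = 1 \<or> e' i = - 1"
      using * by (simp_all add: sign_vectors_def)
    then show ?thesis
      by auto
  qed
  then show ?thesis
    using * by (simp add: sign_vectors_def prod.distrib)
qed

lemma sign_vectors_square: "e \<in> sign_vectors \<Longrightarrow> e i * (e i * x) = x"
proof -
  assume "e \<in> sign_vectors"
  then have "e i = 1 \<or> e i = - 1"
    by (simp add: sign_vectors_def)
  then show ?thesis
    by auto
qed

lemma sign_vectors_flip:
  "i \<noteq> j \<Longrightarrow> (\<lambda>l. if l = i \<or> l = j then - 1 else 1) \<in> (sign_vectors :: ('n::finite \<Rightarrow> 'k::local_field) set)"
proof -
  assume ij: "i \<noteq> j"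
  have "(\<Prod>l\<in>UNIV. if l = i \<or> l = j then - 1 else 1 :: 'k)
      = (\<Prod>l\<in>UNIV. (if l = i then - 1 else 1) * (if l = j then - 1 else 1))"
    using ij by (intro prod.cong) auto
  then show ?thesis
    by (simp add: sign_vectors_def prod.distrib)
qed

lemma exists_power_int_between:
  fixes b :: real
  assumes "b > 1" "x > 0"
  shows "\<exists>m::int. b powi m \<le> x \<and> x < b powi (m + 1)"
proof -
  define m where "m = \<lfloor>log b x\<rfloor>"
  have "b powr real_of_int m \<le> x" "x < b powr real_of_int (m + 1)"
    using assms floor_correct[of "log b x"]
    by (simp_all only: m_def le_log_iff[symmetric] log_less_iff[symmetric])
  moreover have "b powr real_of_int k = b powi k" for k
    using assms(1) by (intro powr_real_of_int') auto
  ultimately have "b powi m \<le> x" "x < b powi (m + 1)"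
    by (simp_all only:)
  then show ?thesis
    by blast
qed

section \<open>Actions of the special linear group\<close>

text \<open>The reduction to a seminorm works for every \<open>CARD('n) >= 3\<close>; dimension 4 is
  separated only in the study of the seminorm.\<close>

locale special_linear_action =
  fixes Z :: "'z metric" and \<phi> :: "'k::local_field ^ 'n ^ 'n::finite \<Rightarrow> 'z \<Rightarrow> 'z"
  assumes injective: "injective_metric Z"
    and isometric: "isometric_action special_linear_group Z \<phi>"
    and proper: "proper_action special_linear_group special_linear_topology Z \<phi>"
    and cobounded: "cobounded_action special_linear_group Z \<phi>"
    and two_neq_0: "(2::'k) \<noteq> 0"
    and card: "CARD('n) \<ge> 3"
begin

lemma action: "group_action special_linear_group (mspace Z) \<phi>"
  using isometric by (simp add: isometric_action_def)

lemma act_mult: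
  "\<lbrakk>det A = 1; det B = 1; x \<in> mspace Z\<rbrakk> \<Longrightarrow> \<phi> (A ** B) x = \<phi> A (\<phi> B x)"
  using group_action.composition_rule[OF action, of x A B] by (simp add: special_linear_group_def)

lemma act_closed [simp]: "\<lbrakk>det A = 1; x \<in> mspace Z\<rbrakk> \<Longrightarrow> \<phi> A x \<in> mspace Z"
  using group_action.element_image[OF action, of A x] by (simp add: special_linear_group_def)

lemma act_one: "x \<in> mspace Z \<Longrightarrow> \<phi> (mat 1) x = x"
  using group_action.id_eq_one[OF action] by (simp add: special_linear_group_def) (metis restrict_apply')

lemma act_image: "det A = 1 \<Longrightarrow> \<phi> A ` mspace Z = mspace Z"
  using group_action.surj_prop[OF action, of A] by (simp add: special_linear_group_def)

lemma act_iso: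
  "\<lbrakk>det A = 1; x \<in> mspace Z; y \<in> mspace Z\<rbrakk> \<Longrightarrow> mdist Z (\<phi> A x) (\<phi> A y) = mdist Z x y"
  using isometric by (simp add: isometric_action_def special_linear_group_def)

text \<open>With \<open>small_displacement_of_bounded\<close>, this translates between displacements
  and matrix entries: here by properness, there by compactness and continuity of the orbit
  map.\<close>

lemma bounded_of_small_displacement:
  assumes "x \<in> mspace Z"
  shows "\<exists>C. \<forall>A. det A = 1 \<and> mdist Z x (\<phi> A x) \<le> r \<longrightarrow> (\<forall>i j. absval (A $ i $ j) \<le> C)"
proof -
  \<comment> \<open>\<open>proper_action\<close> speaks of nonnegative radii, hence
    \<open>max r 0\<close>.\<close>
  define S where "S = {A :: 'k ^ 'n ^ 'n. det A = 1 \<and> mdist Z x (\<phi> A x) \<le> max r 0}"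
  have "compactin special_linear_topology (special_linear_topology closure_of S)"
    using proper assms unfolding proper_action_def S_def
    by (force simp: special_linear_group_def)
  then have "compact (special_linear_topology closure_of S)"
    by (simp add: special_linear_topology_def compactin_subtopology)
  then have "bounded (special_linear_topology closure_of S)"
    by (rule compact_imp_bounded)
  moreover have "S \<subseteq> special_linear_topology closure_of S"
    by (rule closure_of_subset) (auto simp: S_def special_linear_topology_def special_linear_group_def)
  ultimately obtain C where C: "\<And>A. A \<in> S \<Longrightarrow> dist 0 A \<le> C"
    unfolding bounded_any_center[where a = 0] by blast
  have "absval (A $ i $ j) \<le> C" if "det A = 1" "mdist Z x (\<phi> A x) \<le> r" for A i j
  proof -
    have "A \<in> S"
      using that by (simp add: S_def)
    then show ?thesis
      using absval_matrix_le_dist[of A i j] C[of A] by (simp add: dist_commute[of 0])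
  qed
  then show ?thesis
    by blast
qed

lemma small_displacement_of_bounded:
  assumes x: "x \<in> mspace Z"
  shows "\<exists>r. \<forall>A. det A = 1 \<and> (\<forall>i j. absval (A $ i $ j) \<le> C) \<longrightarrow> mdist Z x (\<phi> A x) \<le> r"
proof -
  define K where "K = {A :: 'k ^ 'n ^ 'n. det A = 1 \<and> (\<forall>i j. absval (A $ i $ j) \<le> C)}"
  have K: "compactin special_linear_topology K"
    unfolding special_linear_topology_def compactin_subtopology
    using compact_bounded_det_1[where 'k = 'k and 'n = 'n, of C]
    by (auto simp: K_def special_linear_group_def)
  have "continuous_map special_linear_topology
      (prod_topology special_linear_topology (mtopology_of Z)) (\<lambda>A. (A, x))"
    using x by (simp add: continuous_map_pairwise o_def)
  moreover have "continuous_map (prod_topology special_linear_topology (mtopology_of Z)) (mtopology_of Z)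
      (\<lambda>(A, z). \<phi> A z)"
    using proper by (simp add: proper_action_def)
  ultimately have "continuous_map special_linear_topology (mtopology_of Z) ((\<lambda>(A, z). \<phi> A z) \<circ> (\<lambda>A. (A, x)))"
    by (rule continuous_map_compose)
  then have "continuous_map special_linear_topology (mtopology_of Z) (\<lambda>A. \<phi> A x)"
    by (simp add: o_def)
  then have "compactin (mtopology_of Z) ((\<lambda>A. \<phi> A x) ` K)"
    by (rule image_compactin[OF K])
  then have "Metric_space.mbounded (mspace Z) (mdist Z) ((\<lambda>A. \<phi> A x) ` K)"
    unfolding mtopology_of_def
    by (rule Metric_space.compactin_imp_mbounded[OF Metric_space_mspace_mdist])
  then obtain y r where y: "y \<in> mspace Z \<or> K = {}" "\<And>A. A \<in> K \<Longrightarrow> mdist Z y (\<phi> A x) \<le> r"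
    unfolding Metric_space.mbounded[OF Metric_space_mspace_mdist] by blast
  have "mdist Z x (\<phi> A x) \<le> mdist Z x y + r" if "A \<in> K" for A
    using y that x mdist_triangle[of x Z y "\<phi> A x"] by (fastforce simp: K_def)
  then show ?thesis
    by (auto simp: K_def)
qed

section \<open>Fixed points of the sign matrices\<close>

definition fixed :: "'z \<Rightarrow> bool"
  where "fixed x \<longleftrightarrow> x \<in> mspace Z \<and> (\<forall>e\<in>sign_vectors. \<phi> (diag e) x = x)"

lemma det_sign_vector: "e \<in> sign_vectors \<Longrightarrow> det (diag e) = 1"
  by (simp add: det_diag sign_vectors_def)

text \<open>The sum of the distances to the finite orbit of \<open>x\<close> is invariant. Its term
  for the identity is the distance to \<open>x\<close>, which makes the sum admissible.\<close>

lemma exists_fixed: "\<exists>x. fixed x"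
proof -
  obtain x where x: "x \<in> mspace Z"
    using cobounded by (auto simp: cobounded_action_def)
  define f where "f y = (\<Sum>e\<in>sign_vectors. mdist Z (\<phi> (diag e) x) y)" for y
  have "\<exists>z\<in>mspace Z. (\<forall>s\<in>(\<lambda>e. \<phi> (diag e)) ` sign_vectors. s z = z) \<and> (\<forall>y\<in>mspace Z. mdist Z z y \<le> f y)"
  proof (rule injective_metric_fixed_point[OF injective])
    fix y y' assume y: "y \<in> mspace Z" "y' \<in> mspace Z"
    have f_ge: "mdist Z x y \<le> f y" if "y \<in> mspace Z" for y
    proof -
      have "mdist Z (\<phi> (diag (\<lambda>i. 1)) x) y \<le> f y"
        unfolding f_def by (rule member_le_sum) (simp_all add: sign_vectors_one finite_sign_vectors)
      then show ?thesis
        using x by (simp add: diag_one act_one)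
    qed
    then show "mdist Z y y' \<le> f y + f y'"
      using mdist_triangle[OF y(1) x y(2)] f_ge[OF y(1)] f_ge[OF y(2)]
      by (simp add: mdist_commute[of Z y x])
  next
    fix s y assume "s \<in> (\<lambda>e. \<phi> (diag e)) ` sign_vectors" and y: "y \<in> mspace Z"
    then obtain h where h: "h \<in> sign_vectors" "s = \<phi> (diag h)"
      by blast
    show "f (s y) = f y"
      unfolding f_def
    proof (rule sum.reindex_bij_witness[where i = "\<lambda>e i. h i * e i" and j = "\<lambda>e i. h i * e i"])
      fix e :: "'n \<Rightarrow> 'k" assume e: "e \<in> sign_vectors"
      show "(\<lambda>i. h i * (h i * e i)) = e" "(\<lambda>i. h i * (h i * e i)) = e"
        using sign_vectors_square[OF h(1)] by auto
      show "(\<lambda>i. h i * e i) \<in> sign_vectors" "(\<lambda>i. h i * e i) \<in> sign_vectors"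
        using sign_vectors_mult[OF h(1) e] by auto
      have det: "det (diag h) = 1" "det (diag e) = 1" "det (diag (\<lambda>i. h i * e i)) = 1"
        by (intro det_sign_vector h(1) e sign_vectors_mult)+
      have "mdist Z (\<phi> (diag (\<lambda>i. h i * e i)) x) y
          = mdist Z (\<phi> (diag h) (\<phi> (diag (\<lambda>i. h i * e i)) x)) (\<phi> (diag h) y)"
        using det x y by (simp add: act_iso)
      also have "\<phi> (diag h) (\<phi> (diag (\<lambda>i. h i * e i)) x) = \<phi> (diag e) x"
        using h(1) det x by (simp add: diag_mult sign_vectors_square flip: act_mult)
      finally show "mdist Z (\<phi> (diag (\<lambda>i. h i * e i)) x) y = mdist Z (\<phi> (diag e) x) (s y)"
        by (simp add: h(2))
    qed
  qed (auto simp: act_image act_iso det_sign_vector)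
  then show ?thesis
    by (auto simp: fixed_def)
qed

text \<open>If \<open>e\<^sub>1\<close>, \<open>e\<^sub>2\<close>, \<open>e\<^sub>3\<close> change the signs of the coordinates \<open>{i, j}\<close>, \<open>{i, k}\<close>, \<open>{j, k}\<close>, then
  \<open>1 - e\<^sub>1 - e\<^sub>2 + e\<^sub>3\<close> is \<open>4\<close> times the projection to coordinate \<open>i\<close>. Hence conjugates of
  sign matrices by \<open>A\<close> bound the conjugates of the coordinate projections.\<close>

lemma absval_row_column_le:
  fixes A B :: "'k ^ 'n ^ 'n"
  assumes C: "\<And>e p q. e \<in> sign_vectors \<Longrightarrow> absval ((B ** diag e ** A) $ p $ q) \<le> C"
  shows "absval (B $ p $ i) * absval (A $ i $ q) \<le> 4 * C / absval (4 :: 'k)"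
proof -
  obtain j where j: "j \<noteq> i"
  proof -
    have "\<not> UNIV \<subseteq> {i}"
      using card card_mono[of "{i}" UNIV] by auto
    then show ?thesis
      using that by blast
  qed
  obtain k where k: "k \<noteq> i" "k \<noteq> j"
  proof -
    have "\<not> UNIV \<subseteq> {i, j}"
      using card card_mono[of "{i, j}" UNIV] j by auto
    then show ?thesis
      using that by blast
  qed
  define e :: "'n \<Rightarrow> 'n \<Rightarrow> 'n \<Rightarrow> 'k" where "e a b = (\<lambda>l. if l = a \<or> l = b then - 1 else 1)" for a b
  have e: "e i j \<in> sign_vectors" "e i k \<in> sign_vectors" "e j k \<in> sign_vectors"
    unfolding e_def using j k by (auto intro!: sign_vectors_flip)
  define M where "M u = (B ** diag u ** A) $ p $ q" for u
  have M: "M u = (\<Sum>l\<in>UNIV. B $ p $ l * u l * A $ l $ q)" for u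
    unfolding M_def by (subst matrix_matrix_mult_def) (simp add: mult_diag_nth)
  have "M (\<lambda>l. 1) - M (e i j) - M (e i k) + M (e j k)
      = (\<Sum>l\<in>UNIV. B $ p $ l * (1 - e i j l - e i k l + e j k l) * A $ l $ q)"
    unfolding M by (simp add: algebra_simps sum.distrib sum_subtractf)
  also have "\<dots> = (\<Sum>l\<in>UNIV. if l = i then 4 * (B $ p $ i * A $ i $ q) else 0)"
    using j k by (intro sum.cong) (auto simp: e_def)
  also have "\<dots> = 4 * (B $ p $ i * A $ i $ q)"
    by simp
  finally have "4 * (B $ p $ i * A $ i $ q) = M (\<lambda>l. 1) - M (e i j) - M (e i k) + M (e j k)"
    by simp
  also have "absval \<dots> \<le> C + C + C + C"
  proof -
    have *: "absval (x - y) \<le> absval x + absval y" for x y :: 'k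
      using absval_triangle[of x "- y"] by simp
    have "absval (M u) \<le> C" if "u \<in> sign_vectors" for u
      unfolding M_def using C[OF that] .
    from this[OF sign_vectors_one] this[OF e(1)] this[OF e(2)] this[OF e(3)] show ?thesis
      using absval_triangle[of "M (\<lambda>l. 1) - M (e i j) - M (e i k)" "M (e j k)"]
        *[of "M (\<lambda>l. 1) - M (e i j)" "M (e i k)"] *[of "M (\<lambda>l. 1)" "M (e i j)"]
      by linarith
  qed
  finally have "absval (4 :: 'k) * (absval (B $ p $ i) * absval (A $ i $ q)) \<le> 4 * C"
    by (simp add: absval_mult)
  moreover have "(4 :: 'k) \<noteq> 0"
  proof -
    have "(4 :: 'k) = 2 * 2"
      by simp
    then show ?thesis
      using two_neq_0 by (metis mult_eq_0_iff)
  qed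
  ultimately show ?thesis
    by (simp add: pos_le_divide_eq mult.commute)
qed

end

text \<open>If \<open>\<phi> A x\<close> is near a fixed point, the conjugates of the sign matrices
  by \<open>A\<close> move \<open>x\<close> little and have bounded entries. Hence row
  \<open>i\<close> of \<open>A\<close> and column \<open>i\<close> of its inverse have maxima with
  bounded product, and a torus element can rescale the rows of \<open>A\<close> to bounded
  size.\<close>

lemma (in special_linear_action) torus_cobounded:
  assumes x: "x \<in> mspace Z" and t: "absval t > 1"
  shows "\<exists>r. \<forall>y. fixed y \<longrightarrow> (\<exists>m. mdist Z y (\<phi> (torus t m) x) \<le> r)"
proof -
  have t0: "t \<noteq> 0"
    using t by auto
  define n where "n = CARD('n)"
  have n: "n > 0"
    by (simp add: n_def)
  obtain x0 r0 where x0: "x0 \<in> mspace Z"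
    and r0: "\<And>z. z \<in> mspace Z \<Longrightarrow> \<exists>y\<in>orbit special_linear_group \<phi> x0. mdist Z z y \<le> r0"
    using cobounded unfolding cobounded_action_def by blast
  define r1 where "r1 = r0 + mdist Z x0 x"
  have r1: "\<exists>A. det A = 1 \<and> mdist Z y (\<phi> A x) \<le> r1" if y: "y \<in> mspace Z" for y
  proof -
    obtain A where A: "det A = 1" "mdist Z y (\<phi> A x0) \<le> r0"
      using r0[OF y] by (auto simp: orbit_def special_linear_group_def)
    have "mdist Z y (\<phi> A x) \<le> mdist Z y (\<phi> A x0) + mdist Z (\<phi> A x0) (\<phi> A x)"
      using A(1) x x0 y by (intro mdist_triangle) auto
    then show ?thesis
      using A x x0 by (intro exI[of _ A]) (simp add: r1_def act_iso)
  qed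
  obtain C1 where C1: "\<And>A i j. \<lbrakk>det A = 1; mdist Z x (\<phi> A x) \<le> 2 * r1\<rbrakk> \<Longrightarrow> absval (A $ i $ j) \<le> C1"
    using bounded_of_small_displacement[OF x] by meson
  define C2 where "C2 = 4 * C1 / absval (4 :: 'k)"
  define C3 where "C3 = C2 ^ n * fact n"
  \<comment> \<open>\<open>max 1 C3\<close> will bound \<open>\<sigma>\<close>; the factor
    \<open>absval t ^ n\<close> is the loss from rounding \<open>\<alpha> i\<close> down to a power
    of \<open>absval t ^ n\<close>.\<close>
  define C4 where "C4 = max 1 C3 * absval t ^ n"
  obtain r2 where r2: "\<And>A. \<lbrakk>det A = 1; \<And>i j. absval (A $ i $ j) \<le> C4\<rbrakk> \<Longrightarrow> mdist Z x (\<phi> A x) \<le> r2"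
    using small_displacement_of_bounded[OF x] by meson
  have "\<exists>m. mdist Z y (\<phi> (torus t m) x) \<le> r1 + r2" if y: "fixed y" for y
  proof -
    have yZ: "y \<in> mspace Z"
      using y by (simp add: fixed_def)
    obtain A where A: "det A = 1" and yA: "mdist Z y (\<phi> A x) \<le> r1"
      using r1[OF yZ] by blast
    obtain B where AB: "A ** B = mat 1" "B ** A = mat 1"
      using A invertible_det_nz[of A] by (auto simp: invertible_def)
    have B: "det B = 1"
      using A AB(1) by (metis det_I det_mul mult.left_neutral)
    have conj: "absval ((B ** diag e ** A) $ p $ q) \<le> C1" if e: "e \<in> sign_vectors" for e p q
    proof (rule C1)
      have de: "det (diag e) = 1"
        using e by (rule det_sign_vector)
      then show "det (B ** diag e ** A) = 1"
        by (simp add: det_mul A B)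
      have "mdist Z x (\<phi> (B ** diag e ** A) x) = mdist Z (\<phi> A x) (\<phi> A (\<phi> (B ** diag e ** A) x))"
        using A B de x by (simp add: act_iso det_mul)
      also have "\<phi> A (\<phi> (B ** diag e ** A) x) = \<phi> (diag e) (\<phi> A x)"
        using A B de x AB(1)
        by (simp add: det_mul matrix_mul_assoc flip: act_mult)
      also have "mdist Z (\<phi> A x) (\<phi> (diag e) (\<phi> A x))
          \<le> mdist Z (\<phi> A x) y + mdist Z (\<phi> (diag e) y) (\<phi> (diag e) (\<phi> A x))"
        using mdist_triangle[of "\<phi> A x" Z y "\<phi> (diag e) (\<phi> A x)"] A de x y e
        by (simp add: fixed_def)
      also have "\<dots> \<le> 2 * r1"
        using yA A de x yZ by (simp add: act_iso mdist_commute[of Z "\<phi> A x" y])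
      finally show "mdist Z x (\<phi> (B ** diag e ** A) x) \<le> 2 * r1" .
    qed
    define \<alpha> where "\<alpha> i = Max (range (\<lambda>q. absval (A $ i $ q)))" for i
    define \<beta> where "\<beta> i = Max (range (\<lambda>p. absval (B $ p $ i)))" for i
    have \<alpha>_ge: "absval (A $ i $ q) \<le> \<alpha> i" and \<beta>_ge: "absval (B $ p $ i) \<le> \<beta> i" for i p q
      by (auto simp: \<alpha>_def \<beta>_def)
    have \<alpha>\<beta>: "\<alpha> i * \<beta> i \<le> C2" for i
    proof -
      have "\<alpha> i \<in> range (\<lambda>q. absval (A $ i $ q))" "\<beta> i \<in> range (\<lambda>p. absval (B $ p $ i))"
        unfolding \<alpha>_def \<beta>_def by (intro Max_in; simp)+
      then obtain p q where "\<alpha> i = absval (A $ i $ q)" "\<beta> i = absval (B $ p $ i)"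
        by auto
      then show ?thesis
        using absval_row_column_le[of B A C1 p i q] conj by (simp add: C2_def mult.commute)
    qed
    have \<alpha>_nonneg: "\<alpha> i \<ge> 0" and \<beta>_nonneg: "\<beta> i \<ge> 0" for i
      using \<alpha>_ge \<beta>_ge absval_nonneg order_trans by blast+
    have \<alpha>_pos: "\<alpha> i > 0" for i
    proof (rule ccontr)
      assume "\<not> \<alpha> i > 0"
      then have "absval (A $ i $ q) = 0" for q
        using \<alpha>_ge[of i q] absval_nonneg[of "A $ i $ q"] by linarith
      then have "(A ** B) $ i $ i = 0"
        by (simp add: matrix_matrix_mult_def)
      then show False
        by (simp add: AB(1) mat_def)
    qed
    \<comment> \<open>\<open>det B = 1\<close> bounds the product of the \<open>\<beta> i\<close>
      from below, so \<open>\<alpha> i * \<beta> i <= C2\<close> bounds that of the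
      \<open>\<alpha> i\<close> from above.\<close>
    have prod_\<alpha>: "(\<Prod>i\<in>UNIV. \<alpha> i) \<le> C3"
    proof -
      have "1 \<le> fact n * (\<Prod>i\<in>UNIV. \<beta> i)"
        using absval_det_le[of B \<beta>] \<beta>_ge by (simp add: B n_def)
      then have "(\<Prod>i\<in>UNIV. \<alpha> i) * 1 \<le> (\<Prod>i\<in>UNIV. \<alpha> i) * (fact n * (\<Prod>i\<in>UNIV. \<beta> i))"
        using \<alpha>_nonneg by (intro mult_left_mono prod_nonneg) auto
      also have "\<dots> = (\<Prod>i\<in>UNIV. \<alpha> i * \<beta> i) * fact n"
        by (simp add: prod.distrib)
      also have "\<dots> \<le> (\<Prod>i\<in>(UNIV :: 'n set). C2) * fact n"
        using \<alpha>_nonneg \<beta>_nonneg \<alpha>\<beta> by (intro mult_right_mono prod_mono) auto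
      finally show ?thesis
        by (simp add: C3_def n_def)
    qed
    \<comment> \<open>The torus scales row \<open>i\<close> by \<open>t\<close> to the power
      \<open>n * m $ i\<close> minus the sum of \<open>m\<close>: steps of
      \<open>absval t ^ n\<close> for each row, and a common factor, which becomes
      \<open>\<sigma>\<close>.\<close>
    have "\<exists>k::int. (absval t ^ n) powi k \<le> \<alpha> i \<and> \<alpha> i < (absval t ^ n) powi (k + 1)" for i
      using t n \<alpha>_pos by (intro exists_power_int_between) (auto simp: one_less_power)
    then obtain k where k: "\<And>i. (absval t ^ n) powi k i \<le> \<alpha> i" "\<And>i. \<alpha> i < (absval t ^ n) powi (k i + 1)"
      by metis
    define m where "m = (\<chi> i. k i)"
    define \<sigma> where "\<sigma> = absval t powi (\<Sum>i\<in>UNIV. k i)"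
    have \<sigma>: "0 < \<sigma>" "\<sigma> \<le> max 1 C3"
    proof -
      show "0 < \<sigma>"
        using t unfolding \<sigma>_def by (intro zero_less_power_int) linarith
      have "\<sigma> ^ n = (\<Prod>i\<in>UNIV. (absval t ^ n) powi k i)"
        using t0 by (simp add: prod_power_int_sum \<sigma>_def power_int_power' power_int_power mult.commute sum_distrib_left)
      also have "\<dots> \<le> (\<Prod>i\<in>UNIV. \<alpha> i)"
        using k(1) t by (intro prod_mono) auto
      finally have "\<sigma> ^ n \<le> C3"
        using prod_\<alpha> by linarith
      moreover have "\<sigma> \<le> \<sigma> ^ n" if "\<sigma> \<ge> 1"
        using that n by (simp add: self_le_power)
      ultimately show "\<sigma> \<le> max 1 C3"
        by linarith
    qed
    define D where "D = torus t (- m) ** A"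
    have D: "det D = 1"
      using A t0 by (simp add: D_def det_mul det_torus)
    have "absval (D $ i $ q) \<le> C4" for i q
    proof -
      have "absval (D $ i $ q) = absval t powi (int n * (- k i) + (\<Sum>i\<in>UNIV. k i)) * absval (A $ i $ q)"
        by (simp add: D_def torus_def diag_nth_mult absval_mult absval_power_int m_def n_def sum_negf)
      also have "\<dots> = \<sigma> * (inverse ((absval t ^ n) powi k i) * absval (A $ i $ q))"
      proof -
        have "(absval t ^ n) powi k i = absval t powi (int n * k i)"
          by (simp add: power_int_mult)
        then show ?thesis
          using t0 by (simp add: power_int_diff divide_inverse \<sigma>_def)
      qed
      also have "\<dots> \<le> \<sigma> * (inverse ((absval t ^ n) powi k i) * (absval t ^ n) powi (k i + 1))"
        using \<sigma>(1) t k(2)[of i] \<alpha>_ge[of i q] by (intro mult_left_mono) auto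
      also have "inverse ((absval t ^ n) powi k i) * (absval t ^ n) powi (k i + 1) = absval t ^ n"
        using t0 by (simp add: power_int_add)
      also have "\<sigma> * absval t ^ n \<le> C4"
        unfolding C4_def using \<sigma>(2) t by (intro mult_right_mono) auto
      finally show ?thesis .
    qed
    then have xD: "mdist Z x (\<phi> D x) \<le> r2"
      using D by (intro r2)
    have "torus t m ** D = A"
      using t0 by (simp add: D_def matrix_mul_assoc torus_0 flip: torus_add)
    then have "mdist Z (\<phi> A x) (\<phi> (torus t m) x) = mdist Z (\<phi> D x) x"
      using D x t0 act_iso[of "torus t m" "\<phi> D x" x] by (simp add: det_torus flip: act_mult)
    also have "\<dots> \<le> r2"
      using xD by (simp add: mdist_commute)
    finally have "mdist Z y (\<phi> (torus t m) x) \<le> r1 + r2"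
      using mdist_triangle[of y Z "\<phi> A x" "\<phi> (torus t m) x"] yZ x A yA t0 by (simp add: det_torus)
    then show ?thesis ..
  qed
  then show ?thesis
    by blast
qed

text \<open>The torus commutes with the sign matrices, so the orbit of \<open>x\<close> consists of
  fixed points. Balls around it have a common fixed point, and \<open>torus_cobounded\<close>
  replaces that point by an orbit point.\<close>

lemma (in special_linear_action) displacement_coarsely_hyperconvex:
  assumes x: "fixed x" and t: "absval t > 1"
  shows "\<exists>r. symmetric_coarsely_hyperconvex (\<lambda>m. mdist Z x (\<phi> (torus t m) x)) r"
proof -
  have t0: "t \<noteq> 0"
    using t by auto
  have xZ: "x \<in> mspace Z"
    using x by (simp add: fixed_def)
  define T where "T m = \<phi> (torus t m)" for m
  define \<rho> where "\<rho> m = mdist Z x (T m x)" for m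
  have T_closed: "T m y \<in> mspace Z" if "y \<in> mspace Z" for m y
    using that t0 by (simp add: T_def det_torus)
  have T_add: "T (m + m') y = T m (T m' y)" if "y \<in> mspace Z" for m m' y
    using that t0 by (simp add: T_def torus_add act_mult det_torus)
  have T_iso: "mdist Z (T m y) (T m z) = mdist Z y z" if "y \<in> mspace Z" "z \<in> mspace Z" for m y z
    using that t0 by (simp add: T_def act_iso det_torus)
  have \<rho>_diff: "mdist Z (T m x) (T m' x) = \<rho> (m' - m)" for m m'
    using T_iso[of x "T (m' - m) x" m] T_add[of x m "m' - m"] xZ by (simp add: \<rho>_def T_closed)
  have T_0: "T 0 x = x"
    using xZ by (simp add: T_def torus_0 act_one)
  have \<rho>_minus: "\<rho> (- m) = \<rho> m" for m
    using \<rho>_diff[of m 0] \<rho>_diff[of 0 m] T_0 by (simp add: mdist_commute)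
  obtain r where r: "\<And>y. fixed y \<Longrightarrow> \<exists>m. mdist Z y (T m x) \<le> r"
    using torus_cobounded[OF xZ t] by (auto simp: T_def)
  have T_fixed: "\<phi> (diag e) (T m x) = T m x" if "e \<in> sign_vectors" for e m
  proof -
    have "diag e ** torus t m = torus t m ** diag e"
      by (simp add: torus_def diag_mult mult.commute)
    then have "\<phi> (diag e) (T m x) = T m (\<phi> (diag e) x)"
      using that xZ t0 by (simp add: T_def det_torus det_sign_vector flip: act_mult)
    then show ?thesis
      using x that by (simp add: fixed_def)
  qed
  have "symmetric_coarsely_hyperconvex \<rho> (max r 0)"
  proof
    show "\<rho> m \<ge> 0" for m
      by (simp add: \<rho>_def)
    show "\<rho> (- m) = \<rho> m" for m
      by (rule \<rho>_minus)
    show "\<rho> (m + m') \<le> \<rho> m + \<rho> m'" for m m'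
      using mdist_triangle[of x Z "T m x" "T (m + m') x"] xZ \<rho>_diff[of m "m + m'"]
      by (simp add: \<rho>_def T_closed)
    show "\<rho> (\<chi> i. k) = 0" for k
      using xZ by (simp add: \<rho>_def T_def torus_const act_one)
    show "max r 0 \<ge> 0"
      by simp
    show "\<exists>C. \<forall>m. \<rho> (\<chi> i. m $ p i) \<le> \<rho> m + C" if p: "p permutes UNIV" for p
    proof -
      obtain w :: "'k ^ 'n ^ 'n" where w: "det w = 1" "\<And>a. w ** diag a = diag (\<lambda>i. a (p i)) ** w"
        using permutation_normalizes_diag[OF p] by blast
      \<comment> \<open>Conjugation by \<open>w\<close> permutes the torus but moves the base point
        from \<open>x\<close> to \<open>\<phi> w x\<close>; this displacement is paid twice.\<close>
      have "\<rho> (\<chi> i. m $ p i) \<le> \<rho> m + 2 * mdist Z x (\<phi> w x)" for m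
      proof -
        define m' where "m' = (\<chi> i. m $ p i)"
        have "(\<Sum>j\<in>UNIV. m $ p j) = (\<Sum>j\<in>UNIV. m $ j)"
          using sum.permute[OF p, of "($) m"] by (simp add: o_def)
        then have "w ** torus t m = torus t m' ** w"
          by (simp add: torus_def w(2) m'_def)
        then have wT: "T m' (\<phi> w x) = \<phi> w (T m x)"
          using w(1) xZ t0 by (simp add: T_def det_torus flip: act_mult)
        have "mdist Z x (T m' x) \<le> mdist Z x (\<phi> w x) + mdist Z (\<phi> w x) (T m' (\<phi> w x))
            + mdist Z (T m' (\<phi> w x)) (T m' x)"
          using mdist_triangle[of x Z "\<phi> w x" "T m' x"]
            mdist_triangle[of "\<phi> w x" Z "T m' (\<phi> w x)" "T m' x"] w(1) xZ
          by (simp add: T_closed)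
        also have "mdist Z (T m' (\<phi> w x)) (T m' x) = mdist Z x (\<phi> w x)"
          using w(1) xZ by (simp add: T_iso mdist_commute)
        also have "mdist Z (\<phi> w x) (T m' (\<phi> w x)) = \<rho> m"
          using w(1) xZ by (simp add: wT act_iso T_closed \<rho>_def)
        finally show ?thesis
          by (simp add: \<rho>_def m'_def)
      qed
      then show ?thesis
        by blast
    qed
    show "\<exists>C. \<forall>m. \<rho> m \<le> s \<longrightarrow> real_of_int (m $ i - m $ j) \<le> C" for s i j
    proof -
      obtain C where C: "\<And>A i j. \<lbrakk>det A = 1; mdist Z x (\<phi> A x) \<le> s\<rbrakk> \<Longrightarrow> absval (A $ i $ j) \<le> C"
        using bounded_of_small_displacement[OF xZ] by meson
      obtain b where b: "C < absval t ^ b"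
        using real_arch_pow[OF t] by blast
      have "m $ i - m $ j \<le> int b" if m: "\<rho> m \<le> s" for m
      proof -
        define n where "n = int CARD('n)"
        define a where "a l = n * m $ l - (\<Sum>j\<in>UNIV. m $ j)" for l
        have a_le: "a l \<le> int b" for l
        proof -
          have "absval (torus t m $ l $ l) \<le> C"
            using m t0 by (intro C) (simp_all add: det_torus \<rho>_def T_def)
          then have "absval t powi a l \<le> C"
            by (simp add: torus_def diag_def absval_power_int a_def n_def)
          also have "C < absval t powi int b"
            using b by simp
          finally show ?thesis
            using t by (metis less_imp_le not_le power_int_increasing)
        qed
        \<comment> \<open>Bounded entries bound the exponents \<open>a l\<close> only from above;
          since they add up to 0, this also bounds \<open>a j\<close> from below.\<close>
        have "a j = - (\<Sum>l\<in>UNIV - {j}. a l)"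
        proof -
          have "(\<Sum>l\<in>UNIV. a l) = 0"
            by (simp add: a_def n_def sum_subtractf flip: sum_distrib_left)
          then show ?thesis
            by (simp add: sum.remove[of _ j] add_eq_0_iff2)
        qed
        moreover have "(\<Sum>l\<in>UNIV - {j}. a l) \<le> (n - 1) * int b"
          using sum_mono[of "UNIV - {j}" a "\<lambda>_. int b"] a_le card
          by (simp add: n_def card_Diff_singleton of_nat_diff)
        ultimately have "a i - a j \<le> int b + (n - 1) * int b"
          using a_le[of i] by linarith
        also have "\<dots> = n * int b"
          by (simp add: left_diff_distrib)
        finally have "a i - a j \<le> n * int b" .
        then have "n * (m $ i - m $ j) \<le> n * int b"
          by (simp add: a_def algebra_simps)
        moreover have "n > 0"
          by (simp add: n_def)
        ultimately show ?thesis
          by simp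
      qed
      then show ?thesis
        by (metis of_int_le_iff)
    qed
    fix B :: "((int ^ 'n) \<times> real) set"
    assume B: "finite B" "\<And>m r. (m, r) \<in> B \<Longrightarrow> r \<ge> 0"
      "\<And>m r m' r'. \<lbrakk>(m, r) \<in> B; (m', r') \<in> B\<rbrakk> \<Longrightarrow> \<rho> (m - m') \<le> r + r'"
    show "\<exists>k. \<forall>(m, s)\<in>B. \<rho> (k - m) \<le> s + max r 0"
    proof (cases "B = {}")
      case False
      define B' where "B' = (\<lambda>(m, s). (T m x, s)) ` B"
      define S where "S = (\<lambda>e. \<phi> (diag e)) ` sign_vectors"
      have "\<exists>z\<in>mspace Z. (\<forall>s\<in>S. s z = z) \<and> (\<forall>(y, s)\<in>B'. mdist Z z y \<le> s)"
      proof (rule injective_metric_fixed_point_balls[OF injective])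
        show "B' \<noteq> {}"
          using False by (simp add: B'_def)
        show "B' \<subseteq> mspace Z \<times> {0..}"
          using B(2) xZ by (auto simp: B'_def T_closed)
        show "mdist Z y y' \<le> s + s'" if "(y, s) \<in> B'" "(y', s') \<in> B'" for y s y' s'
          using that B(3) by (auto simp: B'_def \<rho>_diff add.commute)
        show "f y = y" if "f \<in> S" "(y, s) \<in> B'" for f y s
          using that T_fixed by (auto simp: S_def B'_def)
      qed (auto simp: S_def act_image act_iso det_sign_vector)
      then obtain z where z: "fixed z" "\<And>m s. (m, s) \<in> B \<Longrightarrow> mdist Z z (T m x) \<le> s"
        by (fastforce simp: fixed_def S_def B'_def)
      obtain k where k: "mdist Z z (T k x) \<le> r"
        using r[OF z(1)] by blast
      have "\<rho> (k - m) \<le> s + max r 0" if "(m, s) \<in> B" for m s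
      proof -
        have "\<rho> (k - m) \<le> mdist Z (T m x) z + mdist Z z (T k x)"
          using mdist_triangle[of "T m x" Z z "T k x"] z(1) xZ by (simp add: \<rho>_diff fixed_def T_closed)
        then show ?thesis
          using k z(2)[OF that] by (simp add: mdist_commute[of Z "T m x" z])
      qed
      then show ?thesis
        by blast
    qed simp
  qed
  then show ?thesis
    unfolding \<rho>_def T_def by blast
qed

theorem theorem9:
  assumes "non_archimedean TYPE('k::local_field) \<Longrightarrow> CHAR('k) \<noteq> 2"
    and "CARD('n::finite) = 3 \<or> CARD('n) \<ge> 5"
  shows "\<not> coarsely_injective TYPE('z)
    (special_linear_group :: ('k ^ 'n ^ 'n) monoid) special_linear_topology"
proof
  assume "coarsely_injective TYPE('z)
    (special_linear_group :: ('k ^ 'n ^ 'n) monoid) special_linear_topology"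
  then obtain Z :: "'z metric" and \<phi> :: "'k ^ 'n ^ 'n \<Rightarrow> 'z \<Rightarrow> 'z"
    where "injective_metric Z" "isometric_action special_linear_group Z \<phi>"
      "proper_action special_linear_group special_linear_topology Z \<phi>"
      "cobounded_action special_linear_group Z \<phi>"
    unfolding coarsely_injective_def by blast
  moreover have "(2::'k) \<noteq> 0"
    using assms(1) by (rule two_neq_0)
  moreover have "CARD('n) \<ge> 3"
    using assms(2) by linarith
  ultimately interpret special_linear_action Z \<phi>
    by unfold_locales
  obtain t :: 'k where "absval t > 1"
    using exists_absval_gt_1 by blast
  then show False
    using exists_fixed displacement_coarsely_hyperconvex
      symmetric_coarsely_hyperconvex.card_not_3_or_ge_5 assms(2) by blast
qed

end
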